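(* Let $n\ge 1$ and let $\mathcal{F}=\mathcal{F}_\alpha$ be a linear flow with dense leaves on the torus $T^{n+1}$, associated to $\alpha\in\mathbb{R}^n$. Then there is an integer $r$ with $0\le r\le n$ such that $\mathrm{Diff}(T^{n+1}/\mathcal{F})$ is isomorphic to $$(\mathbb{Z}_2\times\underbrace{\mathbb{Z}\times\cdots\times\mathbb{Z}}_{r})\ltimes(T^{n+1}/\mathcal{F}),$$ where $T^{n+1}/\mathcal{F}$ is identified with the group $\mathbb{R}^n/\Gamma$, $\Gamma$ being the holonomy group of $\mathcal{F}$, and $\mathbb{Z}_2\times\mathbb{Z}^r\cong\mathrm{Aut}_\Gamma(\mathbb{R}^n)$ acts on $\mathbb{R}^n/\Gamma$ in the natural way.
   Context: Take coordinates $(x,y_1,\dots,y_n)$ on $\mathbb{R}\times\mathbb{R}^n$ and $T^{n+1}=\mathbb{R}^{n+1}/\mathbb{Z}^{n+1}$. For $\alpha=(\alpha_1,\dots,\alpha_n)\in\mathbb{R}^n$, the linear flow $\mathcal{F}_\alpha$ is the one-dimensional foliation of $T^{n+1}$ defined by the closed $\mathbb{R}^n$-valued $1$-form $\omega=(dy_1-\alpha_1dx,\dots,dy_n-\alpha_ndx)$. Its holonomy group is $\Gamma=\langle e_1,\dots,e_n,\alpha\rangle\subset\mathbb{R}^n$ (subgroup generated), with $e_1,\dots,e_n$ the canonical basis; the leaves are dense if and only if $\Gamma$ is dense in $\mathbb{R}^n$. $\mathrm{Aut}_\Gamma(\mathbb{R}^n)$ is the group of linear automorphisms $\varphi$ of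 $\mathbb{R}^n$ with $\varphi(\Gamma)=\Gamma$; it acts on $\mathbb{R}^n/\Gamma$ by $[v]\mapsto[\varphi(v)]$. The space of leaves $T^{n+1}/\mathcal{F}$ is endowed with the quotient diffeology (its plots are the maps from open sets $U$ of some $\mathbb{R}^p$ which locally lift to $\mathcal{C}^\infty$ maps into $T^{n+1}$); it is diffeomorphic to $\mathbb{R}^n/\Gamma$ with its quotient diffeology (plots locally lift to $\mathcal{C}^\infty$ maps into $\mathbb{R}^n$). A map of diffeological spaces is differentiable if it carries plots to plots by composition, and $\mathrm{Diff}$ denotes the group of differentiable bijections with differentiable inverse. *)

theory Defs
  imports
    "HOL-Analysis.Analysis"
    "HOL-Algebra.Bij"
    "HOL-Algebra.Product_Groups"
    "HOL-Computational_Algebra.Group_Closure"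
begin

section \<open>Smooth maps on open subsets of \<open>\<real>\<^sup>p\<close>, with \<open>p\<close> a natural number\<close>

text \<open>
  A diffeology quantifies over the domains of its plots, hence over \<open>p\<close>, so \<open>\<real>\<^sup>p\<close> is
  the library's \<^const>\<open>Euclidean_space\<close> (functions on \<open>nat\<close> vanishing from \<open>p\<close> on).
  A map is \<open>C\<^sup>k\<close> on the open set \<open>U\<close> if its iterated partial derivatives of order at
  most \<open>k\<close> exist and are continuous on \<open>U\<close>.  Only values of \<open>f\<close> on \<open>U\<close> matter: for
  \<open>u \<in> U\<close>, the point \<open>u(i := t)\<close> is in \<open>U\<close> for \<open>t\<close> close to \<open>u i\<close>.
\<close>

primrec C_k_on ::
    "nat \<Rightarrow> nat \<Rightarrow> (nat \<Rightarrow> real) set \<Rightarrow> ((nat \<Rightarrow> real) \<Rightarrow> 'a::real_normed_vector) \<Rightarrow> bool"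
where
  "C_k_on 0 p U f \<longleftrightarrow> continuous_map (subtopology (Euclidean_space p) U) euclidean f"
| "C_k_on (Suc k) p U f \<longleftrightarrow>
     continuous_map (subtopology (Euclidean_space p) U) euclidean f \<and>
     (\<forall>i<p. \<exists>g. (\<forall>u\<in>U. ((\<lambda>t. f (u(i := t))) has_vector_derivative g u) (at (u i))) \<and>
                C_k_on k p U g)"

definition C_infinity_on ::
    "nat \<Rightarrow> (nat \<Rightarrow> real) set \<Rightarrow> ((nat \<Rightarrow> real) \<Rightarrow> 'a::real_normed_vector) \<Rightarrow> bool"
  where "C_infinity_on p U f \<longleftrightarrow> (\<forall>k. C_k_on k p U f)"


section \<open>Diffeological spaces\<close>

text \<open>
  \<open>plot X p U f\<close> says that \<open>f\<close>, restricted to the open set \<open>U\<close> of \<open>\<real>\<^sup>p\<close>, is a plot of \<open>X\<close>.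
\<close>

record 'a diffeology =
  points :: "'a set"
  plot :: "nat \<Rightarrow> (nat \<Rightarrow> real) set \<Rightarrow> ((nat \<Rightarrow> real) \<Rightarrow> 'a) \<Rightarrow> bool"

definition standard_diffeology :: "'a::euclidean_space diffeology"
  where "standard_diffeology =
    \<lparr>points = UNIV,
     plot = (\<lambda>p U f. openin (Euclidean_space p) U \<and> C_infinity_on p U f)\<rparr>"

definition quotient_diffeology :: "'a diffeology \<Rightarrow> ('a \<Rightarrow> 'b) \<Rightarrow> 'b diffeology"
  where "quotient_diffeology X \<pi> =
    \<lparr>points = \<pi> ` points X,
     plot = (\<lambda>p U f. openin (Euclidean_space p) U \<and>
       (\<forall>u\<in>U. \<exists>V g. u \<in> V \<and> V \<subseteq> U \<and> plot X p V g \<and> (\<forall>v\<in>V. f v = \<pi> (g v))))\<rparr>"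

definition differentiable_map :: "'a diffeology \<Rightarrow> 'b diffeology \<Rightarrow> ('a \<Rightarrow> 'b) \<Rightarrow> bool"
  where "differentiable_map X Y h \<longleftrightarrow>
    h ` points X \<subseteq> points Y \<and> (\<forall>p U f. plot X p U f \<longrightarrow> plot Y p U (h \<circ> f))"

definition diffeomorphism :: "'a diffeology \<Rightarrow> 'b diffeology \<Rightarrow> ('a \<Rightarrow> 'b) \<Rightarrow> bool"
  where "diffeomorphism X Y h \<longleftrightarrow>
    bij_betw h (points X) (points Y) \<and>
    differentiable_map X Y h \<and> differentiable_map Y X (inv_into (points X) h)"

definition Diff :: "'a diffeology \<Rightarrow> ('a \<Rightarrow> 'a) monoid"
  where "Diff X =
    BijGroup (points X) \<lparr>carrier := {h \<in> Bij (points X). diffeomorphism X X h}\<rparr>"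


section \<open>Groups\<close>

definition additive_group :: "'a::ab_group_add monoid"
  where "additive_group = \<lparr>carrier = UNIV, monoid.mult = (+), one = 0\<rparr>"

text \<open>
  \<open>H \<ltimes> N\<close> for an action \<open>act\<close> of \<open>H\<close> on \<open>N\<close>; the pair \<open>(a, c)\<close> stands for the
  transformation \<open>v \<mapsto> c \<cdot> act a v\<close>.
\<close>

definition semidirect_product ::
    "('a, 'm) monoid_scheme \<Rightarrow> ('b, 'k) monoid_scheme \<Rightarrow> ('a \<Rightarrow> 'b \<Rightarrow> 'b) \<Rightarrow> ('a \<times> 'b) monoid"
  where "semidirect_product H N act =
    \<lparr>carrier = carrier H \<times> carrier N,
     monoid.mult = (\<lambda>(a, c) (b, d). (a \<otimes>\<^bsub>H\<^esub> b, c \<otimes>\<^bsub>N\<^esub> act a d)),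
     one = (\<one>\<^bsub>H\<^esub>, \<one>\<^bsub>N\<^esub>)\<rparr>"


section \<open>The torus \<open>T\<^sup>n\<^sup>+\<^sup>1\<close>\<close>

definition quotient_topology :: "'a topology \<Rightarrow> ('a \<Rightarrow> 'b) \<Rightarrow> 'b topology"
  where "quotient_topology X \<pi> =
    topology (\<lambda>W. W \<subseteq> \<pi> ` topspace X \<and> openin X {x \<in> topspace X. \<pi> x \<in> W})"

lemma openin_quotient_topology:
  "openin (quotient_topology X \<pi>) W \<longleftrightarrow>
     W \<subseteq> \<pi> ` topspace X \<and> openin X {x \<in> topspace X. \<pi> x \<in> W}"
proof -
  have "istopology (\<lambda>W. W \<subseteq> \<pi> ` topspace X \<and> openin X {x \<in> topspace X. \<pi> x \<in> W})"
    unfolding istopology_def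
  proof (intro conjI allI impI)
    fix S T
    assume S: "S \<subseteq> \<pi> ` topspace X \<and> openin X {x \<in> topspace X. \<pi> x \<in> S}"
      and T: "T \<subseteq> \<pi> ` topspace X \<and> openin X {x \<in> topspace X. \<pi> x \<in> T}"
    show "S \<inter> T \<subseteq> \<pi> ` topspace X" using S by blast
    have "{x \<in> topspace X. \<pi> x \<in> S \<inter> T} =
        {x \<in> topspace X. \<pi> x \<in> S} \<inter> {x \<in> topspace X. \<pi> x \<in> T}" by blast
    then show "openin X {x \<in> topspace X. \<pi> x \<in> S \<inter> T}"
      using S T by (simp only: openin_Int)
  next
    fix K
    assume K: "\<forall>S\<in>K. S \<subseteq> \<pi> ` topspace X \<and> openin X {x \<in> topspace X. \<pi> x \<in> S}"
    then show "\<Union>K \<subseteq> \<pi> ` topspace X" by blast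
    have "{x \<in> topspace X. \<pi> x \<in> \<Union>K} = (\<Union>S\<in>K. {x \<in> topspace X. \<pi> x \<in> S})" by blast
    moreover have "openin X (\<Union>S\<in>K. {x \<in> topspace X. \<pi> x \<in> S})"
      using K by (intro openin_Union) blast
    ultimately show "openin X {x \<in> topspace X. \<pi> x \<in> \<Union>K}" by (simp only:)
  qed
  then show ?thesis
    by (simp add: quotient_topology_def topology_inverse')
qed

definition integer_lattice :: "(real \<times> (real ^ 'n)) set"
  where "integer_lattice = {(a, b). a \<in> \<int> \<and> (\<forall>i. b $ i \<in> \<int>)}"

definition torus_proj :: "real \<times> (real ^ 'n) \<Rightarrow> (real \<times> (real ^ 'n)) set"
  where "torus_proj z = integer_lattice #>\<^bsub>additive_group\<^esub> z"

definition torus_topology :: "(real \<times> (real ^ 'n)) set topology"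
  where "torus_topology = quotient_topology euclidean torus_proj"

text \<open>
  As \<^const>\<open>torus_proj\<close> is a covering map and a local diffeomorphism, the plots of this
  diffeology are the \<open>C\<^sup>\<infinity>\<close> maps into the manifold \<open>T\<^sup>n\<^sup>+\<^sup>1\<close>.
\<close>

definition torus :: "(real \<times> (real ^ 'n)) set diffeology"
  where "torus = quotient_diffeology standard_diffeology torus_proj"


section \<open>Linear flows\<close>

text \<open>
  The value of \<open>\<omega> = (dy\<^sub>1 - \<alpha>\<^sub>1 dx, \<dots>, dy\<^sub>n - \<alpha>\<^sub>n dx)\<close> on a tangent vector; having constant
  coefficients, \<open>\<omega>\<close> is given by the same formula at all points of the torus.
\<close>

definition flow_form :: "real ^ 'n \<Rightarrow> real \<times> (real ^ 'n) \<Rightarrow> real ^ 'n"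
  where "flow_form \<alpha> = (\<lambda>(dx, dy). dy - dx *\<^sub>R \<alpha>)"

text \<open>
  The leaf through \<open>P\<close> consists of the end points of the \<open>C\<^sup>1\<close> paths from \<open>P\<close> that are
  tangent to the kernel of \<open>\<omega>\<close>.  Paths in the torus are written through their lifts \<open>c\<close>.
\<close>

definition leaf :: "real ^ 'n \<Rightarrow> (real \<times> (real ^ 'n)) set \<Rightarrow> (real \<times> (real ^ 'n)) set set"
  where "leaf \<alpha> P = {Q. \<exists>c c'.
    (\<forall>t\<in>{0..1}. (c has_vector_derivative c' t) (at t within {0..1})) \<and>
    continuous_on {0..1} c' \<and>
    (\<forall>t\<in>{0..1}. flow_form \<alpha> (c' t) = 0) \<and>
    torus_proj (c 0) = P \<and> torus_proj (c 1) = Q}"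

definition leaf_space :: "real ^ 'n \<Rightarrow> (real \<times> (real ^ 'n)) set set diffeology"
  where "leaf_space \<alpha> = quotient_diffeology torus (leaf \<alpha>)"

definition dense_leaves :: "real ^ 'n \<Rightarrow> bool"
  where "dense_leaves \<alpha> \<longleftrightarrow>
    (\<forall>L \<in> points (leaf_space \<alpha>). torus_topology closure_of L = topspace torus_topology)"


section \<open>The holonomy group\<close>

definition holonomy_group :: "real ^ 'n \<Rightarrow> (real ^ 'n) set"
  where "holonomy_group \<alpha> = group_closure (insert \<alpha> (range (\<lambda>i. axis i 1)))"

definition holonomy_quotient :: "real ^ 'n \<Rightarrow> (real ^ 'n) set monoid"
  where "holonomy_quotient \<alpha> = additive_group Mod holonomy_group \<alpha>"

definition holonomy_quotient_space :: "real ^ 'n \<Rightarrow> (real ^ 'n) set diffeology"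
  where "holonomy_quotient_space \<alpha> =
    quotient_diffeology standard_diffeology (\<lambda>v. holonomy_group \<alpha> #>\<^bsub>additive_group\<^esub> v)"

definition Aut_holonomy :: "real ^ 'n \<Rightarrow> (real ^ 'n \<Rightarrow> real ^ 'n) monoid"
  where "Aut_holonomy \<alpha> =
    BijGroup UNIV \<lparr>carrier :=
      {\<phi>. linear \<phi> \<and> bij \<phi> \<and> \<phi> ` holonomy_group \<alpha> = holonomy_group \<alpha>}\<rparr>"

text \<open>
  The identification of \<open>T\<^sup>n\<^sup>+\<^sup>1/\<F>\<close> with \<open>\<real>\<^sup>n/\<Gamma>\<close> is induced by the developing map
  \<open>(x, y) \<mapsto> y - x \<alpha>\<close>: the image under this map of the preimage in \<open>\<real>\<^sup>n\<^sup>+\<^sup>1\<close> of a leaf is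
  a coset of \<open>\<Gamma>\<close>.  (Points of the torus are themselves subsets of \<open>\<real>\<^sup>n\<^sup>+\<^sup>1\<close>, so that
  preimage is \<open>\<Union>L\<close>.)
\<close>

definition leaf_to_coset :: "real ^ 'n \<Rightarrow> (real \<times> (real ^ 'n)) set set \<Rightarrow> (real ^ 'n) set"
  where "leaf_to_coset \<alpha> L = (\<lambda>(x, y). y - x *\<^sub>R \<alpha>) ` \<Union>L"

end

theory Submission
  imports Defs "HOL-Computational_Algebra.Fundamental_Theorem_Algebra"
begin

text \<open>
  Let \<open>\<Gamma>\<close> be the holonomy group. The leaf through \<open>(x, y)\<close> is determined by the class of
  \<open>y - x \<alpha>\<close> modulo \<open>\<Gamma>\<close>, so the leaf space is \<open>\<real>\<^sup>n / \<Gamma>\<close> as a diffeological space, and \<open>\<Gamma>\<close> is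
  dense if the leaves are.

  A differentiable map \<open>h\<close> of \<open>\<real>\<^sup>n / \<Gamma>\<close> lifts to a continuous map \<open>g\<close> near \<open>0\<close>. For
  \<open>\<gamma> \<in> \<Gamma>\<close> the difference \<open>g (x + \<gamma>) - g x\<close> is continuous in \<open>x\<close> with values in the countable
  set \<open>\<Gamma>\<close>, hence constant; as \<open>\<Gamma>\<close> is dense, \<open>g - g 0\<close> is locally additive, hence linear.
  So \<open>h\<close> is induced by an affine map whose linear part preserves \<open>\<Gamma>\<close>.

  Density also makes \<open>1, \<alpha>\<^sub>1, \<dots>, \<alpha>\<^sub>n\<close> linearly independent over \<open>\<rat>\<close>. An automorphism of
  \<open>\<Gamma>\<close> is then an integer matrix having \<open>w = (-1, \<alpha>)\<close> as an eigenvector, and it is determined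
  by the eigenvalue. The structure of this group of eigenvalues is the easy half of Dirichlet's
  unit theorem: common eigenvectors of the commuting integer matrices give at most \<open>n + 1\<close>
  characters; the logarithms of their absolute values embed the positive eigenvalues as a
  discrete subgroup of \<open>\<real>\<^sup>n\<^sup>+\<^sup>1\<close>, because an eigenvalue whose characters are all bounded is
  a root of one of finitely many integer polynomials. This subgroup avoids the negative orthant,
  since the powers of a unit with all characters of absolute value less than \<open>1\<close> would
  contradict discreteness, and so its rank is at most \<open>n\<close>.
\<close>


section \<open>Eigenvalues of integer matrices\<close>

definition of_int_mat :: "int^'m^'m \<Rightarrow> 'a::ring_1^'m^'m"
  where "of_int_mat A = (\<chi> i j. of_int (A $ i $ j))"

text \<open>The matrix \<open>X I - A\<close> over the polynomial ring, so that its determinant is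
  the characteristic polynomial of \<open>A\<close>.\<close>

definition char_matrix :: "'a::comm_ring_1^'m^'m \<Rightarrow> 'a poly^'m^'m"
  where "char_matrix A = (\<chi> i j. if i = j then [:- A $ i $ j, 1:] else [:- A $ i $ j:])"

lemma of_int_mat_mult:
  "of_int_mat (A ** B) = (of_int_mat A ** of_int_mat B :: 'a::comm_ring_1^'m::finite^'m)"
  by (simp add: of_int_mat_def matrix_matrix_mult_def vec_eq_iff)

lemma of_int_mat_1: "of_int_mat (mat 1) = (mat 1 :: 'a::comm_ring_1^'m::finite^'m)"
  by (simp add: of_int_mat_def mat_def vec_eq_iff)

lemma poly_det: "poly (det (M :: 'a::comm_ring_1 poly^'m::finite^'m)) x = det (\<chi> i j. poly (M $ i $ j) x)"
  by (simp add: det_def poly_sum poly_prod)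


text \<open>A permutation other than the identity moves some index \<open>k\<close>. The factor at
  \<open>k\<close> is then a constant, and all other factors have degree at most 1.\<close>

lemma degree_char_matrix_prod_less:
  fixes A :: "'a::idom^'m::finite^'m"
  assumes "p permutes (UNIV::'m set)" "p \<noteq> id"
  shows "degree (\<Prod>i\<in>UNIV. char_matrix A $ i $ p i) < CARD('m)"
proof -
  from assms obtain k where k: "p k \<noteq> k" by (metis eq_id_iff)
  have "degree (\<Prod>i\<in>UNIV. char_matrix A $ i $ p i) \<le> (\<Sum>i\<in>UNIV. degree (char_matrix A $ i $ p i))"
    using degree_prod_sum_le[of UNIV "\<lambda>i. char_matrix A $ i $ p i"] by (simp add: o_def)
  also have "\<dots> \<le> (\<Sum>i\<in>UNIV. if i = k then 0 else 1)"
    by (rule sum_mono) (use k in \<open>auto simp: char_matrix_def\<close>)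
  also have "\<dots> = CARD('m) - 1"
    by (simp add: sum.If_cases card_Diff_singleton Compl_eq_Diff_UNIV)
  finally show ?thesis
    by (metis One_nat_def Suc_pred finite_UNIV_card_ge_0 finite less_Suc_eq_le)
qed

text \<open>In the Leibniz formula only the identity permutation reaches degree
  \<open>CARD('m)\<close>, and its term is a product of monic linear factors.\<close>

lemma char_poly_monic:
  fixes A :: "'a::idom^'m::finite^'m"
  defines "P \<equiv> det (char_matrix A)"
  shows "degree P = CARD('m)" "lead_coeff P = 1"
proof -
  let ?n = "CARD('m)"
  let ?f = "\<lambda>p. of_int (sign p) * (\<Prod>i\<in>UNIV. char_matrix A $ i $ p i)"
  let ?S = "{p. p permutes (UNIV::'m set)}"
  have id: "?f id = (\<Prod>i\<in>UNIV. [:- A $ i $ i, 1:])"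
    by (simp add: char_matrix_def)
  have fin: "finite ?S" by (simp add: finite_permutations)
  have P: "P = ?f id + (\<Sum>p\<in>?S - {id}. ?f p)"
    unfolding P_def det_def by (subst sum.remove[OF fin, of id]) (auto simp: permutes_id)
  have di: "degree (?f id) = ?n"
    unfolding id by (subst degree_prod_eq_sum_degree) auto
  have ci: "coeff (?f id) ?n = 1"
    using di lead_coeff_prod[of "\<lambda>i. [:- A $ i $ i, 1:]" "UNIV::'m set"]
    unfolding id by simp
  have le: "degree (?f p) < ?n" if "p \<in> ?S - {id}" for p
  proof -
    have "?f p = smult (of_int (sign p)) (\<Prod>i\<in>UNIV. char_matrix A $ i $ p i)"
      by (simp add: of_int_poly)
    then show ?thesis
      using degree_char_matrix_prod_less[of p A] that degree_smult_le by (metis DiffE insertI1 le_less_trans mem_Collect_eq)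
  qed
  have ls: "degree (\<Sum>p\<in>?S - {id}. ?f p) < ?n"
    by (rule degree_sum_less) (use le in auto)
  have dP: "degree P = ?n" unfolding P using degree_add_eq_left[of "\<Sum>p\<in>?S - {id}. ?f p" "?f id"] ls di by simp
  show "degree P = CARD('m)" by (fact dP)
  show "lead_coeff P = 1" unfolding dP using ci coeff_eq_0[OF ls] by (simp add: P)
qed

text \<open>Evaluation at \<open>x\<close> turns the determinant into that of
  \<open>x I - A\<close>, which vanishes exactly when this matrix has a nontrivial kernel.\<close>

lemma poly_char_poly_eq_0_iff:
  fixes A :: "'a::field^'m::finite^'m"
  shows "poly (det (char_matrix A)) x = 0 \<longleftrightarrow> (\<exists>v. v \<noteq> 0 \<and> A *v v = x *s v)"
proof -
  let ?B = "mat x - A"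
  have "(\<chi> i j. poly (char_matrix A $ i $ j) x) = ?B"
    by (auto simp: char_matrix_def mat_def vec_eq_iff)
  then have "poly (det (char_matrix A)) x = det ?B"
    by (simp add: poly_det)
  moreover have "det ?B \<noteq> 0 \<longleftrightarrow> (\<forall>v. ?B *v v = 0 \<longrightarrow> v = 0)"
    by (simp add: invertible_det_nz[symmetric] invertible_left_inverse matrix_left_invertible_ker)
  moreover have "?B *v v = x *s v - A *v v" for v
  proof -
    have "mat x *v v = x *s v"
      by (simp add: vec_eq_iff matrix_vector_mult_def mat_def if_distrib if_distribR sum.delta cong: if_cong)
    then show ?thesis by (metis matrix_vector_mult_diff_rdistrib)
  qed
  ultimately show ?thesis by auto
qed

text \<open>Embedding the coefficients is a ring homomorphism, so it commutes with the Leibniz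
  formula. This lets one integer polynomial serve as characteristic polynomial over the reals and
  over the complex numbers.\<close>

lemma map_poly_of_int_det:
  fixes M :: "int poly^'m::finite^'m"
  shows "map_poly of_int (det M) = det (\<chi> i j. map_poly (of_int :: int \<Rightarrow> 'a::{comm_ring_1,ring_char_0}) (M $ i $ j))"
proof -
  have mult: "map_poly (of_int :: int \<Rightarrow> 'a) (p * q) = map_poly of_int p * map_poly of_int q" for p q
    by (rule poly_eqI) (simp add: coeff_map_poly coeff_mult)
  have add: "map_poly (of_int :: int \<Rightarrow> 'a) (p + q) = map_poly of_int p + map_poly of_int q" for p q
    by (rule poly_eqI) (simp add: coeff_map_poly)
  have prod: "map_poly (of_int :: int \<Rightarrow> 'a) (\<Prod>i\<in>I. f i) = (\<Prod>i\<in>I. map_poly of_int (f i))" for f :: "'m \<Rightarrow> int poly" and I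
    by (induction I rule: infinite_finite_induct) (simp_all add: mult)
  have sum: "map_poly (of_int :: int \<Rightarrow> 'a) (\<Sum>i\<in>I. f i) = (\<Sum>i\<in>I. map_poly of_int (f i))" for f :: "('m \<Rightarrow> 'm) \<Rightarrow> int poly" and I
    by (induction I rule: infinite_finite_induct) (simp_all add: add)
  have c: "map_poly (of_int :: int \<Rightarrow> 'a) (of_int k) = of_int k" for k
    by (simp add: of_int_poly map_poly_pCons)
  show ?thesis
    unfolding det_def by (simp add: sum mult prod c)
qed

lemma map_poly_char_poly:
  "map_poly of_int (det (char_matrix A)) = det (char_matrix (of_int_mat A :: 'a::{comm_ring_1,ring_char_0}^'m::finite^'m))"
  unfolding map_poly_of_int_det
  by (rule arg_cong[where f=det]) (auto simp: char_matrix_def of_int_mat_def vec_eq_iff map_poly_pCons)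

text \<open>Induction on the degree, splitting off a root \<open>z\<close>: a coefficient of
  \<open>[:-z, 1:] * q\<close> is a coefficient of \<open>q\<close> minus \<open>z\<close> times the
  next one, so each factor enlarges the bound by at most \<open>1 + B\<close>.\<close>

lemma coeff_bound_of_root_bound:
  fixes p :: "complex poly"
  assumes "lead_coeff p = 1" "\<And>z. poly p z = 0 \<Longrightarrow> cmod z \<le> B" "0 \<le> B"
  shows "cmod (coeff p i) \<le> (1 + B) ^ degree p"
  using assms(1,2)
proof (induction "degree p" arbitrary: p i)
  case 0
  then show ?case using \<open>0 \<le> B\<close>
    by (cases "i = 0") (auto simp: coeff_eq_0)
next
  case (Suc d)
  have "\<not> constant (poly p)" using Suc.hyps(2) by (simp add: constant_degree)
  then obtain z where z: "poly p z = 0" using fundamental_theorem_of_algebra by blast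
  then obtain q where q: "p = [:-z, 1:] * q" by (metis poly_eq_0_iff_dvd dvd_def)
  have q0: "q \<noteq> 0" using q Suc.hyps(2) by auto
  have dq: "degree q = d" using Suc.hyps(2) q0 unfolding q by (subst (asm) degree_mult_eq) auto
  have lq: "lead_coeff q = 1" using Suc.prems(1) unfolding q by (simp only: lead_coeff_mult) simp
  have rq: "cmod y \<le> B" if "poly q y = 0" for y
    using Suc.prems(2)[of y] that by (simp add: q)
  have b: "cmod (coeff q i) \<le> (1+B)^d" for i
    using Suc.hyps(1)[of q i] dq lq rq by auto
  have zB: "cmod z \<le> B" using Suc.prems(2) z by blast
  have "coeff p i = (case i of 0 \<Rightarrow> 0 | Suc j \<Rightarrow> coeff q j) - z * coeff q i"
    by (simp add: q coeff_pCons split: nat.split)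
  then have "cmod (coeff p i) \<le> cmod (case i of 0 \<Rightarrow> 0 | Suc j \<Rightarrow> coeff q j) + cmod z * cmod (coeff q i)"
    by (metis norm_triangle_ineq4 norm_mult)
  also have "\<dots> \<le> (1+B)^d + B * (1+B)^d"
    using b \<open>0 \<le> B\<close> zB by (intro add_mono mult_mono) (auto split: nat.split)
  also have "\<dots> = (1+B) ^ degree p" using Suc.hyps(2) by (simp flip: Suc.hyps(2) add: algebra_simps)
  finally show ?case .
qed

lemma finite_bounded_int_polys: "finite {p :: int poly. degree p \<le> n \<and> (\<forall>i. \<bar>real_of_int (coeff p i)\<bar> \<le> C)}"
proof (rule finite_subset)
  let ?L = "{xs. set xs \<subseteq> {-\<lfloor>C\<rfloor>..\<lfloor>C\<rfloor>} \<and> length xs \<le> Suc n}"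
  show "finite (Poly ` ?L)" by (intro finite_imageI finite_lists_length_le) auto
  show "{p :: int poly. degree p \<le> n \<and> (\<forall>i. \<bar>real_of_int (coeff p i)\<bar> \<le> C)} \<subseteq> Poly ` ?L"
  proof
    fix p :: "int poly" assume p: "p \<in> {p. degree p \<le> n \<and> (\<forall>i. \<bar>real_of_int (coeff p i)\<bar> \<le> C)}"
    then have "\<bar>coeff p i\<bar> \<le> \<lfloor>C\<rfloor>" for i
      by (simp add: le_floor_iff)
    then have "coeff p i \<in> {-\<lfloor>C\<rfloor>..\<lfloor>C\<rfloor>}" for i
      by (metis abs_le_D1 abs_le_D2 atLeastAtMost_iff minus_le_iff)
    then have "coeffs p \<in> ?L"
      using p by (auto simp: coeffs_def simp del: atLeastAtMost_iff)
    then show "p \<in> Poly ` ?L" by (rule rev_image_eqI) simp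
  qed
qed

text \<open>A bound on the complex roots bounds the coefficients of the characteristic polynomial.
  Only finitely many integer polynomials satisfy such a bound, and each has finitely many real
  roots.\<close>

lemma finite_real_eigenvalues_of_bounded_spectrum:
  "finite {x::real. \<exists>A::int^'m::finite^'m. (\<exists>v. v \<noteq> 0 \<and> of_int_mat A *v v = x *s v) \<and>
     (\<forall>z::complex. (\<exists>v. v \<noteq> 0 \<and> of_int_mat A *v v = z *s v) \<longrightarrow> cmod z \<le> B)}"
    (is "finite ?E")
proof -
  \<comment> \<open>\<open>B\<close> may be negative, whereas the coefficient bound wants a
    nonnegative radius.\<close>
  define C where "C = (1 + max B 0) ^ CARD('m)"
  let ?Q = "{p :: int poly. degree p \<le> CARD('m) \<and> (\<forall>i. \<bar>real_of_int (coeff p i)\<bar> \<le> C)} - {0}"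
  have "?E \<subseteq> (\<Union>p\<in>?Q. {x. poly (map_poly real_of_int p) x = 0})"
  proof
    fix x assume "x \<in> ?E"
    then obtain A :: "int^'m^'m" where A: "\<exists>v. v \<noteq> 0 \<and> of_int_mat A *v v = x *s v"
      "\<And>z::complex. (\<exists>v. v \<noteq> 0 \<and> of_int_mat A *v v = z *s v) \<Longrightarrow> cmod z \<le> B" by blast
    let ?p = "det (char_matrix A)"
    let ?c = "det (char_matrix (of_int_mat A :: complex^'m^'m))"
    have p: "poly (map_poly real_of_int ?p) x = 0"
      unfolding map_poly_char_poly poly_char_poly_eq_0_iff by (fact A)
    have "cmod (coeff ?c i) \<le> C" for i
      using coeff_bound_of_root_bound[of ?c "max B 0" i, OF char_poly_monic(2)] A(2)
      unfolding poly_char_poly_eq_0_iff char_poly_monic(1) C_def by (auto simp: le_max_iff_disj)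
    then have "\<bar>real_of_int (coeff ?p i)\<bar> \<le> C" for i
      unfolding map_poly_char_poly[symmetric] by (simp add: coeff_map_poly)
    moreover have "?p \<noteq> 0" using char_poly_monic(2)[of A] by auto
    ultimately have "?p \<in> ?Q" using char_poly_monic(1)[of A] by simp
    then show "x \<in> (\<Union>p\<in>?Q. {x. poly (map_poly real_of_int p) x = 0})" using p by blast
  qed
  moreover have "finite (\<Union>p\<in>?Q. {x. poly (map_poly real_of_int p) x = 0})"
  proof (intro finite_UN_I finite_Diff finite_bounded_int_polys poly_roots_finite)
    fix p :: "int poly" assume "p \<in> ?Q"
    then have "coeff (map_poly real_of_int p) (degree p) \<noteq> 0" by (simp add: coeff_map_poly)
    then show "map_poly real_of_int p \<noteq> 0" by auto
  qed
  ultimately show ?thesis by (rule finite_subset)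
qed


section \<open>Common eigenvectors of commuting matrices\<close>

text \<open>The vector \<open>p(A) v\<close>, evaluated by Horner's rule so that no powers of the
  matrix are needed.\<close>

definition krylov :: "'a::field^'m^'m \<Rightarrow> 'a^'m \<Rightarrow> 'a poly \<Rightarrow> 'a^'m::finite"
  where "krylov A v p = fold_coeffs (\<lambda>a y. a *s v + A *v y) p 0"

lemma krylov_0 [simp]: "krylov A v 0 = 0"
  by (simp add: krylov_def)

lemma krylov_pCons: "krylov A v (pCons a p) = a *s v + A *v krylov A v p"
  by (cases "p = 0 \<and> a = 0") (auto simp: krylov_def)

lemma krylov_add: "krylov A v (p + q) = krylov A v p + krylov A v q"
  by (induction p q rule: poly_induct2)
     (simp_all add: krylov_pCons algebra_simps)

lemma krylov_smult: "krylov A v (smult c p) = c *s krylov A v p"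
  by (induction p) (simp_all add: krylov_pCons vec.scale_right_distrib vec.scale)

lemma krylov_sum: "krylov A v (\<Sum>i\<in>I. f i) = (\<Sum>i\<in>I. krylov A v (f i))"
  by (induction I rule: infinite_finite_induct) (simp_all add: krylov_add)

text \<open>Used to read off an eigenvector: if the left side vanishes, \<open>A\<close> acts on
  \<open>krylov A v q\<close> as \<open>z\<close>.\<close>

lemma krylov_linear_factor: "krylov A v ([:-z, 1:] * q) = A *v krylov A v q - z *s krylov A v q"
proof -
  have "krylov A v ([:-z, 1:] * q) = krylov A v (smult (-z) q + pCons 0 q)" by simp
  also have "\<dots> = A *v krylov A v q - z *s krylov A v q"
    unfolding krylov_add krylov_smult krylov_pCons by (simp add: vec.scale_minus_left)
  finally show ?thesis .
qed

lemma krylov_in_subspace: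
  assumes "vec.subspace W" "v \<in> W" "\<And>w. w \<in> W \<Longrightarrow> A *v w \<in> W"
  shows "krylov A v p \<in> W"
  by (induction p) (auto simp: krylov_pCons assms intro!: vec.subspace_0 vec.subspace_add vec.subspace_scale)

text \<open>The vectors \<open>v, A v, ..., A^N v\<close>, with \<open>N\<close> the dimension, are
  one too many to be independent.\<close>

lemma ex_annihilating_poly:
  fixes A :: "'a::field^'m^'m::finite"
  shows "\<exists>p. p \<noteq> 0 \<and> krylov A v p = 0"
proof -
  let ?f = "\<lambda>i. krylov A v (monom 1 i)" and ?N = "CARD('m)"
  show ?thesis
  proof (cases "inj_on ?f {..?N}")
    \<comment> \<open>Dependence is a property of sets here, so two coinciding vectors in the list
      are a case of their own.\<close>
    case False
    then obtain i j where ij: "i \<noteq> j" "?f i = ?f j" by (auto simp: inj_on_def)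
    have "krylov A v (monom 1 i + smult (-1) (monom 1 j)) = 0"
      unfolding krylov_add krylov_smult using ij by simp
    moreover have "monom 1 i + smult (-1) (monom 1 j) \<noteq> (0 :: 'a poly)"
      using ij(1) by (auto simp: poly_eq_iff)
    ultimately show ?thesis by blast
  next
    case True
    then have card: "card (?f ` {..?N}) = Suc ?N" by (simp add: card_image)
    have "vec.dependent (?f ` {..?N})"
    proof (rule ccontr)
      assume "vec.independent (?f ` {..?N})"
      from vec.dim_eq_card_independent[OF this] show False
        using card dim_subset_UNIV_cart_gen[of "?f ` {..?N}"] by linarith
    qed
    then obtain u where u: "\<exists>w\<in>?f ` {..?N}. u w \<noteq> 0" "(\<Sum>w\<in>?f ` {..?N}. u w *s w) = 0"
      using vec.dependent_finite[of "?f ` {..?N}"] by blast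
    let ?p = "\<Sum>i\<le>?N. smult (u (?f i)) (monom 1 i)"
    have "krylov A v ?p = 0"
      unfolding krylov_sum krylov_smult using u(2) by (simp add: sum.reindex[OF True])
    moreover obtain i where i: "i \<le> ?N" "u (?f i) \<noteq> 0" using u(1) by auto
    then have "coeff ?p i \<noteq> 0" by (simp add: coeff_sum if_distrib sum.delta cong: if_cong)
    then have "?p \<noteq> 0" by auto
    ultimately show ?thesis by blast
  qed
qed

text \<open>Let \<open>p\<close> be of least degree with \<open>p(A) v = 0\<close>, and split
  \<open>p = (X - z) q\<close> at a complex root. Then \<open>q(A) v\<close> is nonzero by
  minimality, is killed by \<open>A - z\<close>, and lies in \<open>W\<close> by invariance.\<close>

lemma eigenvector_in_invariant_subspace:
  fixes A :: "complex^'m^'m::finite"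
  assumes W: "vec.subspace W" "\<And>w. w \<in> W \<Longrightarrow> A *v w \<in> W" and v: "v \<in> W" "v \<noteq> 0"
  shows "\<exists>u\<in>W. u \<noteq> 0 \<and> (\<exists>z. A *v u = z *s u)"
proof -
  define p where "p = (ARG_MIN degree p. p \<noteq> 0 \<and> krylov A v p = 0)"
  obtain p0 where p0: "p0 \<noteq> 0 \<and> krylov A v p0 = 0" using ex_annihilating_poly by blast
  have p: "p \<noteq> 0 \<and> krylov A v p = 0"
    unfolding p_def by (rule arg_min_natI[where P="\<lambda>p. p \<noteq> 0 \<and> krylov A v p = 0", OF p0])
  have min: "degree p \<le> degree q" if "q \<noteq> 0" "krylov A v q = 0" for q
    unfolding p_def by (rule arg_min_nat_le) (use that in auto)
  have "degree p \<noteq> 0"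
  proof
    assume "degree p = 0"
    then obtain c where "p = [:c:]" by (meson degree_eq_zeroE)
    then show False using p v by (auto simp: krylov_pCons)
  qed
  then have "\<not> constant (poly p)" by (simp add: constant_degree)
  then obtain z where "poly p z = 0" using fundamental_theorem_of_algebra by blast
  then obtain q where q: "p = [:-z, 1:] * q" by (metis poly_eq_0_iff_dvd dvd_def)
  have q0: "q \<noteq> 0" using p q by auto
  have "degree q < degree p" unfolding q using q0 by (subst degree_mult_eq) auto
  then have "krylov A v q \<noteq> 0" using min[OF q0] by auto
  moreover have "A *v krylov A v q = z *s krylov A v q"
    using p krylov_linear_factor[of A v z q] q by simp
  ultimately show ?thesis using krylov_in_subspace[OF W(1) v(1) W(2)] by blast
qed

text \<open>Among the nonzero subspaces of the \<open>z\<close>-eigenspace of \<open>A\<close> that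
  are invariant under \<open>T\<close>, take one of least dimension. Each \<open>B\<close> in
  \<open>T\<close> has an eigenvector in it, and the corresponding eigenspace inside it is again
  invariant because \<open>T\<close> is commutative. By minimality it is everything, so
  \<open>B\<close> acts as a scalar.\<close>

lemma common_eigenvector:
  fixes T :: "(complex^'m^'m::finite) set"
  assumes comm: "\<And>A B. A \<in> T \<Longrightarrow> B \<in> T \<Longrightarrow> A ** B = B ** A"
    and A: "A \<in> T" and v: "A *v v = z *s v" "v \<noteq> 0"
  shows "\<exists>u. u \<noteq> 0 \<and> A *v u = z *s u \<and> (\<forall>B\<in>T. \<exists>c. B *v u = c *s u)"
proof -
  define P where "P = (\<lambda>W. vec.subspace W \<and> W \<noteq> {0} \<and> (\<forall>w\<in>W. A *v w = z *s w) \<and> (\<forall>B\<in>T. \<forall>w\<in>W. B *v w \<in> W))"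
  have swap: "B *v (C *v w) = C *v (B *v w)" if "B \<in> T" "C \<in> T" for B C w
    using comm[OF that] by (simp add: matrix_vector_mul_assoc)
  have sub: "P {w \<in> W. B *v w = c *s w}" if "vec.subspace W" "B \<in> T" "\<forall>B\<in>T. \<forall>w\<in>W. B *v w \<in> W"
    "u \<in> W" "u \<noteq> 0" "B *v u = c *s u" "\<forall>w\<in>{w \<in> W. B *v w = c *s w}. A *v w = z *s w" for W B c u
    unfolding P_def
  proof (intro conjI ballI)
    show "vec.subspace {w \<in> W. B *v w = c *s w}"
    proof (rule vec.subspaceI)
      show "0 \<in> {w \<in> W. B *v w = c *s w}" using vec.subspace_0[OF that(1)] by simp
      show "x + y \<in> {w \<in> W. B *v w = c *s w}"
        if "x \<in> {w \<in> W. B *v w = c *s w}" "y \<in> {w \<in> W. B *v w = c *s w}" for x y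
        using that vec.subspace_add[OF \<open>vec.subspace W\<close>, of x y] by (simp add: vec.add vec.scale_right_distrib)
      show "k *s x \<in> {w \<in> W. B *v w = c *s w}" if "x \<in> {w \<in> W. B *v w = c *s w}" for k x
        using that vec.subspace_scale[OF \<open>vec.subspace W\<close>, of x k] by (simp add: vec.scale mult.commute)
    qed
    show "{w \<in> W. B *v w = c *s w} \<noteq> {0}" using that by blast
    show "A *v w = z *s w" if "w \<in> {w \<in> W. B *v w = c *s w}" for w
      by (rule bspec[OF \<open>\<forall>w\<in>{w \<in> W. B *v w = c *s w}. A *v w = z *s w\<close> that])
    show "C *v w \<in> {w \<in> W. B *v w = c *s w}" if "C \<in> T" "w \<in> {w \<in> W. B *v w = c *s w}" for C w
      using that swap[OF \<open>B \<in> T\<close>, of C w] bspec[OF bspec[OF \<open>\<forall>B\<in>T. \<forall>w\<in>W. B *v w \<in> W\<close>], of C w]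
      by (simp add: vec.scale)
  qed
  \<comment> \<open>The closure property \<open>sub\<close> is used twice: here with
    \<open>A\<close> itself on the whole space, to have some candidate, and below to cut down the
    minimal one.\<close>
  have "P {w \<in> UNIV. A *v w = z *s w}"
    by (rule sub[of _ _ v]) (use A v in auto)
  then have ex: "\<exists>W. P W" by blast
  define W where "W = (ARG_MIN vec.dim W. P W)"
  have W: "P W" unfolding W_def using ex by (metis arg_min_natI)
  have Wmin: "vec.dim W \<le> vec.dim W'" if "P W'" for W'
    unfolding W_def by (rule arg_min_nat_le[of P W' vec.dim, OF that])
  have sW: "vec.subspace W" using W by (simp add: P_def)
  obtain u where u: "u \<in> W" "u \<noteq> 0" using W vec.subspace_0[OF sW] unfolding P_def by blast
  have "\<exists>c. B *v u = c *s u" if B: "B \<in> T" for B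
  proof -
    obtain x c where x: "x \<in> W" "x \<noteq> 0" "B *v x = c *s x"
      using eigenvector_in_invariant_subspace[of W B u] W u B unfolding P_def by blast
    let ?W = "{w \<in> W. B *v w = c *s w}"
    have PW: "P ?W" by (rule sub[of W B x c]) (use W B x in \<open>auto simp: P_def\<close>)
    then have "?W = W" using vec.subspace_dim_equal[of ?W W] Wmin[OF PW] sW by (auto simp: P_def)
    then show ?thesis using u by blast
  qed
  then show ?thesis using u W unfolding P_def by blast
qed

text \<open>The elements of \<open>Y\<close> are the families of eigenvalues themselves, so distinct
  \<open>s\<close> and \<open>t\<close> differ at some \<open>k\<close>. Applying
  \<open>T k - t k\<close> removes the term of \<open>t\<close> and multiplies the coefficient of
  \<open>s\<close> by the nonzero \<open>s k - t k\<close>.\<close>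

lemma common_eigenvectors_independent:
  fixes v :: "('k \<Rightarrow> 'a::field) \<Rightarrow> 'a^'m::finite"
  assumes "finite Y" "\<And>s. s \<in> Y \<Longrightarrow> v s \<noteq> 0" "\<And>s k. s \<in> Y \<Longrightarrow> T k *v v s = s k *s v s"
    "(\<Sum>s\<in>Y. c s *s v s) = 0" "s \<in> Y"
  shows "c s = 0"
  using assms
proof (induction Y arbitrary: c s rule: finite_induct)
  case (insert t Y)
  have z: "c s = 0" if s: "s \<in> Y" for s
  proof -
    obtain k where k: "s k \<noteq> t k" using insert.hyps s by (metis ext)
    have "0 = T k *v (\<Sum>s\<in>insert t Y. c s *s v s) - t k *s (\<Sum>s\<in>insert t Y. c s *s v s)"
      unfolding insert.prems(3) by simp
    also have "\<dots> = (\<Sum>s\<in>insert t Y. c s *s (T k *v v s)) - (\<Sum>s\<in>insert t Y. t k *s (c s *s v s))"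
      by (simp only: vec.sum vec.scale vec.scale_sum_right)
    also have "\<dots> = (\<Sum>s\<in>insert t Y. (c s * (s k - t k)) *s v s)"
      unfolding sum_subtractf[symmetric]
      by (rule sum.cong) (auto simp: insert.prems(2) vec_eq_iff algebra_simps)
    also have "\<dots> = (\<Sum>s\<in>Y. (c s * (s k - t k)) *s v s)"
      using insert.hyps by simp
    finally have "c s * (s k - t k) = 0"
      using insert.IH[of "\<lambda>s. c s * (s k - t k)" s] insert.prems s by simp
    then show ?thesis using k by simp
  qed
  have "(\<Sum>s\<in>Y. c s *s v s) = 0" by (rule sum.neutral) (simp add: z)
  then have "c t *s v t = 0" using insert.prems(3) insert.hyps by simp
  then have "c t = 0" using insert.prems(1)[of t] by simp
  then show ?case using z insert.prems(4) by blast
qed simp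

lemma card_common_eigencharacters_le:
  fixes v :: "('k \<Rightarrow> 'a::field) \<Rightarrow> 'a^'m::finite"
  assumes Y: "finite Y" "\<And>s. s \<in> Y \<Longrightarrow> v s \<noteq> 0" "\<And>s k. s \<in> Y \<Longrightarrow> T k *v v s = s k *s v s"
  shows "card Y \<le> CARD('m)"
proof -
  have inj: "inj_on v Y"
  proof (rule inj_onI)
    fix s t assume st: "s \<in> Y" "t \<in> Y" "v s = v t"
    have "s k *s v s = t k *s v s" for k using Y(3) st by metis
    then have "s k = t k" for k using Y(2)[OF st(1)] by (metis vec.scale_right_imp_eq)
    then show "s = t" by blast
  qed
  have "vec.independent (v ` Y)"
  proof (rule ccontr)
    assume "\<not> vec.independent (v ` Y)"
    then obtain u where u: "\<exists>w\<in>v ` Y. u w \<noteq> 0" "(\<Sum>w\<in>v ` Y. u w *s w) = 0"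
      using vec.dependent_finite[OF finite_imageI[OF Y(1)], of v] by blast
    then have "(\<Sum>s\<in>Y. u (v s) *s v s) = 0" by (simp add: sum.reindex[OF inj])
    then have "u (v s) = 0" if "s \<in> Y" for s
      using common_eigenvectors_independent[of Y v T "\<lambda>s. u (v s)" s] Y that by blast
    then show False using u(1) by blast
  qed
  then have "card (v ` Y) = vec.dim (v ` Y)" by (simp add: vec.dim_eq_card_independent)
  also have "\<dots> \<le> CARD('m)" by (rule dim_subset_UNIV_cart_gen)
  finally show ?thesis by (simp add: card_image[OF inj])
qed


section \<open>Discrete subgroups of Euclidean spaces\<close>

text \<open>
  The new basis vector \<open>d\<close> has the least positive coefficient along \<open>c\<close> modulo \<open>span B\<close>. A least one
  exists because reducing modulo \<open>B\<close> brings all candidates into a bounded set.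
\<close>

lemma extend_lattice_basis:
  fixes L :: "'a::euclidean_space set"
  assumes diff: "\<And>x y. x \<in> L \<Longrightarrow> y \<in> L \<Longrightarrow> x - y \<in> L"
    and fin: "\<And>R. finite {x \<in> L. norm x \<le> R}"
    and B: "finite B" "B \<subseteq> L" "L \<inter> span B \<subseteq> range (\<lambda>k. \<Sum>b\<in>B. of_int (k b) *\<^sub>R b)"
    and c: "c \<in> L" "c \<notin> span B"
  shows "\<exists>d\<in>L. d \<notin> span B \<and> span (insert d B) = span (insert c B) \<and>
    L \<inter> span (insert d B) \<subseteq> range (\<lambda>k. \<Sum>b\<in>insert d B. of_int (k b) *\<^sub>R b)"
proof -
  have zero: "0 \<in> L" using diff[OF c(1) c(1)] by simp
  have neg: "- x \<in> L" if "x \<in> L" for x using diff[OF zero that] by simp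
  have add: "x + y \<in> L" if "x \<in> L" "y \<in> L" for x y using diff[OF that(1) neg[OF that(2)]] by simp
  have nat: "of_nat n *\<^sub>R x \<in> L" if "x \<in> L" for n x
    by (induction n) (use zero add that in \<open>auto simp: algebra_simps\<close>)
  have int: "of_int n *\<^sub>R x \<in> L" if "x \<in> L" for n x
    using nat[OF that] neg[OF nat[OF that]] by (cases n) (metis of_int_of_nat_eq, metis of_int_minus of_int_of_nat_eq scaleR_minus_left)
  have isum: "(\<Sum>b\<in>B'. of_int (k b) *\<^sub>R b) \<in> L" if "B' \<subseteq> L" for k B'
    using that by (induction B' rule: infinite_finite_induct) (auto intro: zero add int)
  \<comment> \<open>The coefficients along \<open>c\<close>, modulo \<open>span B\<close>, that
    lattice vectors attain in the interval from 0 (excluded) to 1. The vector \<open>c\<close>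
    itself contributes 1.\<close>
  define P where "P = {t. 0 < t \<and> t \<le> 1 \<and> (\<exists>x\<in>L. x - t *\<^sub>R c \<in> span B)}"
  define R where "R = norm c + (\<Sum>b\<in>B. norm b)"
  have uniq: "s = t" if "x - s *\<^sub>R c \<in> span B" "x - t *\<^sub>R c \<in> span B" for x s t
  proof (rule ccontr)
    assume "s \<noteq> t"
    have "(t - s) *\<^sub>R c \<in> span B" using span_diff[OF that] by (simp add: algebra_simps)
    then have "(1 / (t - s)) *\<^sub>R ((t - s) *\<^sub>R c) \<in> span B" by (rule span_scale)
    then show False using c(2) \<open>s \<noteq> t\<close> by simp
  qed
  \<comment> \<open>By \<open>uniq\<close> a vector determines its coefficient. Subtracting the
    integer parts of the coordinates in \<open>B\<close> keeps the coefficient and makes the vector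
    no longer than \<open>R\<close>, so \<open>P\<close> is an image of a finite set.\<close>
  have "P \<subseteq> (\<lambda>x. THE t. x - t *\<^sub>R c \<in> span B) ` {x \<in> L. norm x \<le> R}"
  proof
    fix t assume "t \<in> P"
    then obtain x where t: "0 < t" "t \<le> 1" "x \<in> L" "x - t *\<^sub>R c \<in> span B" by (auto simp: P_def)
    then obtain u where u: "x - t *\<^sub>R c = (\<Sum>b\<in>B. u b *\<^sub>R b)" using span_finite[OF B(1)] by auto
    define y where "y = x - (\<Sum>b\<in>B. of_int \<lfloor>u b\<rfloor> *\<^sub>R b)"
    have yL: "y \<in> L" unfolding y_def by (intro diff t isum B)
    have y: "y - t *\<^sub>R c = (\<Sum>b\<in>B. frac (u b) *\<^sub>R b)"
      using u by (simp add: y_def frac_def scaleR_diff_left sum_subtractf algebra_simps)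
    have "norm y \<le> norm (t *\<^sub>R c) + norm (y - t *\<^sub>R c)" by (rule norm_triangle_sub)
    also have "\<dots> \<le> norm c + (\<Sum>b\<in>B. norm b)" unfolding y
    proof (rule add_mono)
      show "norm (t *\<^sub>R c) \<le> norm c" using t by (simp add: mult_left_le_one_le)
      show "norm (\<Sum>b\<in>B. frac (u b) *\<^sub>R b) \<le> (\<Sum>b\<in>B. norm b)"
        by (rule sum_norm_le) (simp add: frac_lt_1 less_imp_le mult_left_le_one_le frac_ge_0)
    qed
    finally have "norm y \<le> R" by (simp add: R_def)
    moreover have ys: "y - t *\<^sub>R c \<in> span B" unfolding y by (intro span_sum span_scale span_base)
    then have "(THE t. y - t *\<^sub>R c \<in> span B) = t" using uniq by blast
    ultimately show "t \<in> (\<lambda>x. THE t. x - t *\<^sub>R c \<in> span B) ` {x \<in> L. norm x \<le> R}"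
      using yL by force
  qed
  then have finP: "finite P" using fin finite_surj by blast
  have "1 \<in> P" using c span_0 by (force simp: P_def)
  define t where "t = Min P"
  have "t \<in> P" unfolding t_def using finP \<open>1 \<in> P\<close> by (intro Min_in) auto
  then obtain d where t: "0 < t" "t \<le> 1" and d: "d \<in> L" "d - t *\<^sub>R c \<in> span B" by (auto simp: P_def)
  have min: "t \<le> s" if "s \<in> P" for s unfolding t_def using finP that by simp
  have dn: "d \<notin> span B"
  proof
    assume "d \<in> span B"
    then show False using uniq[of d 0 t] d t by simp
  qed
  have c': "c - (1/t) *\<^sub>R d \<in> span B"
  proof -
    have "(-1/t) *\<^sub>R (d - t *\<^sub>R c) \<in> span B" using d(2) by (rule span_scale)
    then show ?thesis using t by (simp add: algebra_simps)
  qed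
  have sp: "span (insert d B) = span (insert c B)"
  proof -
    have "d \<in> span (insert c B)" "c \<in> span (insert d B)"
      using d(2) c' by (auto simp: span_breakdown_eq)
    then have "insert d B \<subseteq> span (insert c B)" "insert c B \<subseteq> span (insert d B)"
      by (auto intro: span_base)
    then show ?thesis by (metis span_mono span_span subset_antisym)
  qed
  have "L \<inter> span (insert d B) \<subseteq> range (\<lambda>k. \<Sum>b\<in>insert d B. of_int (k b) *\<^sub>R b)"
  proof
    fix x assume x: "x \<in> L \<inter> span (insert d B)"
    then obtain r where r: "x - r *\<^sub>R d \<in> span B" by (auto simp: span_breakdown_eq)
    define n where "n = \<lfloor>r\<rfloor>"
    define y where "y = x - of_int n *\<^sub>R d"
    have yL: "y \<in> L" unfolding y_def using x by (intro diff int d) auto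
    have yr: "y - frac r *\<^sub>R d \<in> span B" using r by (simp add: y_def n_def frac_def algebra_simps)
    have ys: "y - (frac r * t) *\<^sub>R c \<in> span B"
      using span_add[OF yr span_scale[OF d(2), of "frac r"]] by (simp add: algebra_simps)
    \<comment> \<open>Otherwise \<open>y\<close> would attain the coefficient
      \<open>frac r * t\<close>, smaller than the minimum \<open>t\<close>.\<close>
    have "frac r = 0"
    proof (rule ccontr)
      assume "frac r \<noteq> 0"
      then have "0 < frac r" by (simp add: order_less_le)
      moreover have "frac r * t < t" using t frac_lt_1[of r] by simp
      ultimately have "frac r * t \<in> P" using t yL ys by (auto simp: P_def intro: order_trans[of _ t])
      then show False using min \<open>frac r * t < t\<close> by force
    qed
    with yr have "y \<in> span B" by (simp only: scaleR_zero_left diff_zero)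
    then have "y \<in> L \<inter> span B" using yL by simp
    then obtain k where k: "y = (\<Sum>b\<in>B. of_int (k b) *\<^sub>R b)" using B(3) by blast
    have "d \<notin> B" using dn span_base by blast
    have "x = (\<Sum>b\<in>insert d B. of_int ((k(d := n)) b) *\<^sub>R b)"
    proof -
      have "(\<Sum>b\<in>B. of_int ((k(d := n)) b) *\<^sub>R b) = y"
        unfolding k by (rule sum.cong) (use \<open>d \<notin> B\<close> in auto)
      then show ?thesis using \<open>d \<notin> B\<close> B(1) by (simp add: y_def)
    qed
    then show "x \<in> range (\<lambda>k. \<Sum>b\<in>insert d B. of_int (k b) *\<^sub>R b)" 
      by (rule image_eqI[where x = "k(d := n)"]) (rule UNIV_I)
  qed
  then show ?thesis using d(1) dn sp by blast
qed

text \<open>Start from a maximal independent subset \<open>C\<close> of \<open>L\<close> and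
  exchange its vectors one at a time for lattice basis vectors with the same span. Since
  \<open>L\<close> lies in \<open>span C\<close>, the final basis generates all of
  \<open>L\<close>.\<close>

lemma discrete_subgroup_basis:
  fixes L :: "'a::euclidean_space set"
  assumes diff: "\<And>x y. x \<in> L \<Longrightarrow> y \<in> L \<Longrightarrow> x - y \<in> L"
    and fin: "\<And>R. finite {x \<in> L. norm x \<le> R}"
  obtains B where "finite B" "B \<subseteq> L" "independent B" "L \<subseteq> range (\<lambda>k. \<Sum>b\<in>B. of_int (k b) *\<^sub>R b)"
proof -
  obtain C where C: "C \<subseteq> L" "independent C" "L \<subseteq> span C"
    by (rule maximal_independent_subset)
  have "finite C" using C(2) by (rule independent_imp_finite)
  then have "\<exists>B. finite B \<and> B \<subseteq> L \<and> independent B \<and> span B = span C \<and>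
      L \<inter> span B \<subseteq> range (\<lambda>k. \<Sum>b\<in>B. of_int (k b) *\<^sub>R b)"
    using C(1,2)
  proof (induction C rule: finite_induct)
    case empty
    then show ?case by (intro exI[of _ "{}"]) auto
  next
    case (insert c C)
    have iC: "independent C" using insert.prems(2) by (rule independent_mono) auto
    then obtain B where B: "finite B" "B \<subseteq> L" "independent B" "span B = span C"
      "L \<inter> span B \<subseteq> range (\<lambda>k. \<Sum>b\<in>B. of_int (k b) *\<^sub>R b)"
      using insert.IH[OF _ iC] insert.prems(1) by blast
    have "c \<notin> span B" using insert.prems(2) insert.hyps(2) by (simp add: B(4) independent_insert)
    then obtain d where d: "d \<in> L" "d \<notin> span B" "span (insert d B) = span (insert c B)"
      "L \<inter> span (insert d B) \<subseteq> range (\<lambda>k. \<Sum>b\<in>insert d B. of_int (k b) *\<^sub>R b)"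
      using extend_lattice_basis[OF diff fin B(1,2,5), of c] insert.prems(1) by blast
    have "span (insert c B) = span (insert c C)" using B(4) by (auto simp: span_breakdown_eq B(4))
    moreover have "independent (insert d B)" using B(3) d(2) independent_insert[of d B] by auto
    moreover have "finite (insert d B)" "insert d B \<subseteq> L" using B(1,2) d(1) by auto
    moreover have "span (insert d B) = span (insert c C)"
      using d(3) \<open>span (insert c B) = span (insert c C)\<close> by (rule trans)
    ultimately show ?case using d(4) by (intro exI[of _ "insert d B"] conjI)
  qed
  then obtain B where "finite B" "B \<subseteq> L" "independent B" "span B = span C"
      "L \<inter> span B \<subseteq> range (\<lambda>k. \<Sum>b\<in>B. of_int (k b) *\<^sub>R b)" by blast
  then show ?thesis using that[of B] C(3) by blast
qed

text \<open>Round the coordinates of the point with all entries \<open>-R\<close> down to integers.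
  The error is at most the sum of the norms of the basis vectors, which is less than
  \<open>R\<close>.\<close>

lemma lattice_meets_negative_orthant:
  fixes B :: "(real^'m::finite) set"
  assumes B: "independent B" "card B = CARD('m)"
  shows "\<exists>k::real^'m \<Rightarrow> int. \<forall>i. (\<Sum>b\<in>B. of_int (k b) *\<^sub>R b) $ i < 0"
proof -
  define R where "R = (\<Sum>b\<in>B. norm b) + 1"
  have fin: "finite B" using B(1) by (rule independent_imp_finite)
  have "span B = UNIV" using B dim_eq_full[of B] by (simp add: dim_eq_card_independent)
  then have "vec (-R) \<in> span B" by simp
  then obtain u where u: "vec (-R) = (\<Sum>b\<in>B. u b *\<^sub>R b)" using span_finite[OF fin] by auto
  let ?y = "\<Sum>b\<in>B. of_int \<lfloor>u b\<rfloor> *\<^sub>R b"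
  have "?y $ i < 0" for i
  proof -
    have "?y - vec (-R) = - (\<Sum>b\<in>B. frac (u b) *\<^sub>R b)"
      unfolding u by (simp add: frac_def scaleR_diff_left sum_subtractf)
    then have "norm (?y - vec (-R)) = norm (\<Sum>b\<in>B. frac (u b) *\<^sub>R b)" by simp
    also have "\<dots> \<le> (\<Sum>b\<in>B. norm b)"
      by (rule sum_norm_le) (simp add: frac_lt_1 less_imp_le mult_left_le_one_le frac_ge_0)
    finally have "norm (?y - vec (-R)) < R" by (simp add: R_def)
    then have "\<bar>(?y - vec (-R)) $ i\<bar> < R" using component_le_norm_cart[of "?y - vec (-R)" i] by linarith
    then show ?thesis by simp
  qed
  then show ?thesis by (intro exI[of _ "\<lambda>b. \<lfloor>u b\<rfloor>"]) blast
qed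


section \<open>Units of the multiplier ring of a lattice in \<open>\<real>\<close>\<close>

locale integrally_independent =
  fixes w :: "real^'m::finite"
  assumes indep: "(\<Sum>i\<in>UNIV. of_int (k $ i) * w $ i) = 0 \<Longrightarrow> k = (0 :: int^'m)"
begin

text \<open>An integer matrix with \<open>T w = x w\<close> exists exactly when multiplication by
  \<open>x\<close> maps the lattice spanned by the entries of \<open>w\<close> into itself. The
  condition on \<open>inverse x\<close> makes \<open>x\<close> a unit.\<close>

definition multiplier_units :: "real set"
  where "multiplier_units = {x. x \<noteq> 0 \<and> (\<exists>T. of_int_mat T *v w = x *s w) \<and> (\<exists>T. of_int_mat T *v w = inverse x *s w)}"

text \<open>
  Meaningful only for \<open>x\<close> in the multiplier ring of the lattice spanned by the entries of \<open>w\<close>.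
\<close>

definition mult_mat :: "real \<Rightarrow> int^'m^'m"
  where "mult_mat x = (THE T. of_int_mat T *v w = x *s w)"

text \<open>
  Setting the characters to \<open>0\<close> outside the units makes them a finite set of functions.
\<close>

definition eigencharacters :: "(real \<Rightarrow> complex) set"
  where "eigencharacters = {s. (\<forall>x. x \<notin> multiplier_units \<longrightarrow> s x = 0) \<and>
    (\<exists>v. v \<noteq> 0 \<and> (\<forall>x\<in>multiplier_units. of_int_mat (mult_mat x) *v v = s x *s v))}"

text \<open>Each row of \<open>S - T\<close> is an integer relation between the entries of
  \<open>w\<close>.\<close>

lemma of_int_mat_eq:
  assumes "of_int_mat S *v w = of_int_mat T *v w"
  shows "S = T"
proof -
  have "S $ i - T $ i = 0" for i
  proof (rule indep)
    have "(of_int_mat S *v w) $ i - (of_int_mat T *v w) $ i = 0" using assms by simp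
    then show "(\<Sum>j\<in>UNIV. of_int ((S $ i - T $ i) $ j) * w $ j) = 0"
      by (simp add: matrix_vector_mult_def of_int_mat_def sum_subtractf left_diff_distrib)
  qed
  then show ?thesis by (simp add: vec_eq_iff)
qed

lemma mult_mat_eqI: "of_int_mat T *v w = x *s w \<Longrightarrow> mult_mat x = T"
  unfolding mult_mat_def using of_int_mat_eq by (intro the_equality) auto

lemma mult_mat: "x \<in> multiplier_units \<Longrightarrow> of_int_mat (mult_mat x) *v w = x *s w"
  using mult_mat_eqI by (auto simp: multiplier_units_def)

lemma nonzero: "w \<noteq> 0"
proof
  assume "w = 0"
  then have "(1 :: int^'m) = 0" by (intro indep) simp
  then show False by (simp add: vec_eq_iff)
qed

section \<open>Group laws of the multiplier units\<close>

lemma units_mult_aux: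
  assumes "of_int_mat S *v w = x *s w" "of_int_mat T *v w = y *s w"
  shows "of_int_mat (S ** T) *v w = (x * y) *s w"
proof -
  have "of_int_mat (S ** T) *v w = of_int_mat S *v (of_int_mat T *v w)"
    by (simp add: of_int_mat_mult matrix_vector_mul_assoc)
  also have "\<dots> = (x * y) *s w" by (simp add: assms vec.scale mult.commute)
  finally show ?thesis .
qed

lemma units_mult: "x \<in> multiplier_units \<Longrightarrow> y \<in> multiplier_units \<Longrightarrow> x * y \<in> multiplier_units"
  unfolding multiplier_units_def using units_mult_aux by (simp add: inverse_mult_distrib) blast

lemma mult_mat_mult:
  "x \<in> multiplier_units \<Longrightarrow> y \<in> multiplier_units \<Longrightarrow> mult_mat (x * y) = mult_mat x ** mult_mat y"
  by (intro mult_mat_eqI units_mult_aux mult_mat)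

lemma mult_mat_1: "mult_mat 1 = mat 1"
  by (rule mult_mat_eqI) (simp add: of_int_mat_1)

lemma units_1: "1 \<in> multiplier_units"
  unfolding multiplier_units_def by (auto intro: exI[of _ "mat 1"] simp: of_int_mat_1)

lemma units_inverse: "x \<in> multiplier_units \<Longrightarrow> inverse x \<in> multiplier_units"
  by (simp add: multiplier_units_def)

lemma units_minus: "x \<in> multiplier_units \<Longrightarrow> - x \<in> multiplier_units"
proof -
  have "of_int_mat (- T) *v w = (- y) *s w" if "of_int_mat T *v w = y *s w" for T y
  proof -
    have "of_int_mat (- T) *v w = - (of_int_mat T *v w)"
      by (simp add: of_int_mat_def matrix_vector_mult_def vec_eq_iff sum_negf)
    then show ?thesis using that by (simp add: vec.scale_minus_left)
  qed
  then show "x \<in> multiplier_units \<Longrightarrow> - x \<in> multiplier_units"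
    unfolding multiplier_units_def by (simp add: inverse_minus_eq) blast
qed

lemma units_nonzero: "x \<in> multiplier_units \<Longrightarrow> x \<noteq> 0"
  by (simp add: multiplier_units_def)

lemma units_power: "x \<in> multiplier_units \<Longrightarrow> x ^ n \<in> multiplier_units"
  by (induction n) (auto intro: units_1 units_mult)

section \<open>Characters of the unit group\<close>

lemma eigencharacter_mult:
  assumes "s \<in> eigencharacters" "x \<in> multiplier_units" "y \<in> multiplier_units"
  shows "s (x * y) = s x * s y"
proof -
  obtain v where v: "v \<noteq> 0" "\<And>x. x \<in> multiplier_units \<Longrightarrow> of_int_mat (mult_mat x) *v v = s x *s v"
    using assms(1) by (auto simp: eigencharacters_def)
  have "s (x * y) *s v = of_int_mat (mult_mat x) *v (of_int_mat (mult_mat y) *v v)"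
    using v(2)[of "x * y"] units_mult[OF assms(2,3)]
    by (simp add: mult_mat_mult assms of_int_mat_mult matrix_vector_mul_assoc)
  also have "\<dots> = (s x * s y) *s v" by (simp add: v(2) assms vec.scale mult.commute)
  finally show ?thesis using v(1) by (metis vec.scale_right_imp_eq)
qed

lemma eigencharacter_1: "s \<in> eigencharacters \<Longrightarrow> s 1 = 1"
proof -
  assume "s \<in> eigencharacters"
  then obtain v where v: "v \<noteq> 0" "\<And>x. x \<in> multiplier_units \<Longrightarrow> of_int_mat (mult_mat x) *v v = s x *s v"
    by (auto simp: eigencharacters_def)
  have "s 1 *s v = 1 *s v" using v(2)[OF units_1] by (simp add: mult_mat_1 of_int_mat_1)
  then show ?thesis using v(1) by (metis vec.scale_right_imp_eq)
qed

lemma eigencharacter_nonzero: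
  assumes "s \<in> eigencharacters" "x \<in> multiplier_units"
  shows "s x \<noteq> 0"
  using eigencharacter_mult[OF assms units_inverse[OF assms(2)]] eigencharacter_1[OF assms(1)]
    units_nonzero[OF assms(2)] by auto

lemma eigencharacter_power:
  assumes "s \<in> eigencharacters" "x \<in> multiplier_units"
  shows "s (x ^ n) = s x ^ n"
  by (induction n) (simp_all add: assms eigencharacter_1 eigencharacter_mult units_power)

lemma card_eigencharacters: "finite eigencharacters" "card eigencharacters \<le> CARD('m)"
proof -
  \<comment> \<open>Extended by 0 in agreement with the convention for
    \<open>eigencharacters\<close>, so that the eigenvector equation holds for every real
    \<open>x\<close>.\<close>
  define T :: "real \<Rightarrow> complex^'m^'m"
    where "T x = (if x \<in> multiplier_units then of_int_mat (mult_mat x) else 0)" for x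
  have "\<exists>v. v \<noteq> 0 \<and> (\<forall>x. T x *v v = s x *s v)" if "s \<in> eigencharacters" for s
    using that unfolding eigencharacters_def T_def by auto
  then obtain v where v: "\<And>s. s \<in> eigencharacters \<Longrightarrow> v s \<noteq> 0"
      "\<And>s x. s \<in> eigencharacters \<Longrightarrow> T x *v v s = s x *s v s" by metis
  have "card Y \<le> CARD('m)" if "finite Y" "Y \<subseteq> eigencharacters" for Y
    by (rule card_common_eigencharacters_le[where v = v and T = T]) (use that v in blast)+
  then show "finite eigencharacters" "card eigencharacters \<le> CARD('m)"
    using finite_if_finite_subsets_card_bdd[of eigencharacters "CARD('m)"] by blast+
qed

text \<open>The matrices of units commute because real multiplication does, so a common eigenvector
  can be found inside the given eigenspace. Hence the characters at \<open>x\<close> exhaust the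
  complex spectrum of the matrix of \<open>x\<close>.\<close>

lemma eigenvalue_imp_eigencharacter:
  assumes x: "x \<in> multiplier_units" and v: "of_int_mat (mult_mat x) *v v = z *s v" "v \<noteq> 0"
  shows "\<exists>s\<in>eigencharacters. s x = z"
proof -
  let ?M = "\<lambda>x. of_int_mat (mult_mat x) :: complex^'m^'m"
  have comm: "A ** B = B ** A" if A: "A \<in> ?M ` multiplier_units" and B: "B \<in> ?M ` multiplier_units" for A B
  proof -
    obtain x y where xy: "x \<in> multiplier_units" "y \<in> multiplier_units" "A = ?M x" "B = ?M y"
      using A B by blast
    then show ?thesis by (metis of_int_mat_mult mult_mat_mult mult.commute)
  qed
  obtain u where u: "u \<noteq> 0" "?M x *v u = z *s u" "\<And>y. y \<in> multiplier_units \<Longrightarrow> \<exists>c. ?M y *v u = c *s u"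
    using common_eigenvector[of "?M ` multiplier_units", OF comm imageI[of x multiplier_units ?M, OF x] v] by auto
  then obtain c where c: "\<And>y. y \<in> multiplier_units \<Longrightarrow> ?M y *v u = c y *s u" by metis
  define s where "s y = (if y \<in> multiplier_units then c y else 0)" for y
  have "s \<in> eigencharacters" unfolding eigencharacters_def s_def using u(1) c by auto
  moreover have "s x = z" using u(1,2) c[OF x] x unfolding s_def by (metis vec.scale_right_imp_eq)
  ultimately show ?thesis by blast
qed

lemma eigencharacters_nonempty: "eigencharacters \<noteq> {}"
  using eigenvalue_imp_eigencharacter[OF units_1, of 1 1]
  by (auto simp: mult_mat_1 of_int_mat_1 vec_eq_iff)

text \<open>A unit \<open>x\<close> is an eigenvalue of its own matrix, with eigenvector
  \<open>w\<close>, and the whole spectrum of that matrix consists of character values at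
  \<open>x\<close>.\<close>

lemma finite_units_bounded:
  "finite {x \<in> multiplier_units. \<forall>s\<in>eigencharacters. cmod (s x) \<le> B}"
proof (rule finite_subset)
  show "finite {x::real. \<exists>A::int^'m^'m. (\<exists>v. v \<noteq> 0 \<and> of_int_mat A *v v = x *s v) \<and>
     (\<forall>z::complex. (\<exists>v. v \<noteq> 0 \<and> of_int_mat A *v v = z *s v) \<longrightarrow> cmod z \<le> B)}"
    by (rule finite_real_eigenvalues_of_bounded_spectrum)
  show "{x \<in> multiplier_units. \<forall>s\<in>eigencharacters. cmod (s x) \<le> B} \<subseteq> \<dots>"
  proof (clarify, intro exI conjI allI impI)
    fix x assume x: "x \<in> multiplier_units" "\<forall>s\<in>eigencharacters. cmod (s x) \<le> B"
    show "w \<noteq> 0" by (fact nonzero)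
    show "of_int_mat (mult_mat x) *v w = x *s w" using x(1) by (rule mult_mat)
    fix z :: complex assume "\<exists>v. v \<noteq> 0 \<and> of_int_mat (mult_mat x) *v v = z *s v"
    then show "cmod z \<le> B" using eigenvalue_imp_eigencharacter[OF x(1)] x(2) by blast
  qed
qed

text \<open>If \<open>x\<close> were not 1, its powers would be infinitely many units with bounded
  characters. This takes over the role that the norm of a unit has in the classical proof of
  Dirichlet's theorem.\<close>

lemma unit_eq_1_if_eigencharacters_le_1:
  assumes x: "x \<in> multiplier_units" "0 < x" and le: "\<And>s. s \<in> eigencharacters \<Longrightarrow> cmod (s x) \<le> 1"
  shows "x = 1"
proof (rule ccontr)
  assume "x \<noteq> 1"
  then have "inj (\<lambda>n. x ^ n)" using x(2) by (auto intro!: injI simp: power_inject_exp')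
  moreover have "range (\<lambda>n. x ^ n) \<subseteq> {x \<in> multiplier_units. \<forall>s\<in>eigencharacters. cmod (s x) \<le> 1}"
    using x le by (auto simp: units_power eigencharacter_power norm_power power_le_one)
  then have "finite (range (\<lambda>n. x ^ n))" using finite_units_bounded[of 1] by (rule finite_subset)
  ultimately show False using range_inj_infinite by blast
qed

text \<open>The coordinates of \<open>l x\<close> are the logarithms of the absolute values of the
  characters at \<open>x\<close>. The second property is what makes \<open>l\<close> injective on
  positive units and keeps their image off the negative orthant; the third makes the image
  discrete.\<close>

lemma log_embedding:
  obtains l :: "real \<Rightarrow> real^'m" where
    "\<And>x y. x \<in> multiplier_units \<Longrightarrow> y \<in> multiplier_units \<Longrightarrow> l (x * y) = l x + l y"
    "\<And>x. x \<in> multiplier_units \<Longrightarrow> 0 < x \<Longrightarrow> (\<And>i. l x $ i \<le> 0) \<Longrightarrow> x = 1"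
    "\<And>R. finite {x \<in> multiplier_units. norm (l x) \<le> R}"
proof -
  obtain g :: "(real \<Rightarrow> complex) \<Rightarrow> 'm" where g: "inj_on g eigencharacters"
    using card_eigencharacters by (metis card_le_inj finite_class.finite_UNIV)
  \<comment> \<open>There may be fewer characters than coordinates; the remaining coordinates repeat
    an arbitrary character, so that all of them are additive.\<close>
  define e where "e i = (if i \<in> g ` eigencharacters then inv_into eigencharacters g i else (SOME s. s \<in> eigencharacters))" for i
  have e: "e i \<in> eigencharacters" for i
    unfolding e_def using eigencharacters_nonempty by (auto intro: inv_into_into some_in_eq[THEN iffD2])
  have se: "e (g s) = s" if "s \<in> eigencharacters" for s using that g by (simp add: e_def)
  define l :: "real \<Rightarrow> real^'m" where "l x = (\<chi> i. ln (cmod (e i x)))" for x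
  have pos: "0 < cmod (e i x)" if "x \<in> multiplier_units" for i x
    using eigencharacter_nonzero[OF e that] by simp
  show ?thesis
  proof (rule that)
    show "l (x * y) = l x + l y" if "x \<in> multiplier_units" "y \<in> multiplier_units" for x y
      using pos[OF that(1)] pos[OF that(2)]
      by (simp add: l_def vec_eq_iff eigencharacter_mult[OF e] that norm_mult ln_mult_pos del: zero_less_norm_iff)
    show "x = 1" if "x \<in> multiplier_units" "0 < x" "\<And>i. l x $ i \<le> 0" for x
    proof (rule unit_eq_1_if_eigencharacters_le_1[OF that(1,2)])
      fix s assume "s \<in> eigencharacters"
      then show "cmod (s x) \<le> 1" using that(3)[of "g s"] pos[OF that(1), of "g s"] by (simp add: l_def se)
    qed
    show "finite {x \<in> multiplier_units. norm (l x) \<le> R}" for R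
    proof (rule finite_subset[OF _ finite_units_bounded[of "exp R"]], clarify)
      fix x s assume x: "x \<in> multiplier_units" "norm (l x) \<le> R" and s: "s \<in> eigencharacters"
      have "l x $ g s \<le> R" using component_le_norm_cart[of "l x" "g s"] x(2) by linarith
      then have "exp (l x $ g s) \<le> exp R" by simp
      then show "cmod (s x) \<le> exp R"
        using pos[OF x(1), of "g s"] s by (simp add: l_def se del: exp_le_cancel_iff zero_less_norm_iff)
    qed
  qed
qed

definition unit_group :: "real monoid"
  where "unit_group = \<lparr>carrier = multiplier_units, monoid.mult = (*), one = 1\<rparr>"

text \<open>Logarithms identify the positive units with a discrete subgroup of
  \<open>real^'m\<close>, and a lattice basis \<open>B\<close> of it pulls back to free generators.
  The rank is less than \<open>CARD('m)\<close>, as a lattice of full rank would meet the open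
  negative orthant.\<close>

lemma positive_units_free:
  obtains r c where "r < CARD('m)" "\<And>i. i < r \<Longrightarrow> c i \<in> multiplier_units \<and> 0 < c i"
    "\<And>x. x \<in> multiplier_units \<Longrightarrow> 0 < x \<Longrightarrow> \<exists>k. x = (\<Prod>i<r. c i powi k i)"
    "\<And>i (k :: nat \<Rightarrow> int) k'. (\<Prod>i<r. c i powi k i) = (\<Prod>i<r. c i powi k' i) \<Longrightarrow> i < r \<Longrightarrow> k i = k' i"
proof -
  define U where "U = {x \<in> multiplier_units. 0 < x}"
  obtain l :: "real \<Rightarrow> real^'m" where
    l_mult: "\<And>x y. x \<in> multiplier_units \<Longrightarrow> y \<in> multiplier_units \<Longrightarrow> l (x * y) = l x + l y" and
    l_neg: "\<And>x. x \<in> multiplier_units \<Longrightarrow> 0 < x \<Longrightarrow> (\<And>i. l x $ i \<le> 0) \<Longrightarrow> x = 1" and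
    l_fin: "\<And>R. finite {x \<in> multiplier_units. norm (l x) \<le> R}"
    using log_embedding by blast
  have Um: "x * y \<in> U" and Ui: "inverse x \<in> U" if "x \<in> U" "y \<in> U" for x y
    using that by (auto simp: U_def units_mult units_inverse)
  have U1: "1 \<in> U" by (simp add: U_def units_1)
  have lU: "l (x * y) = l x + l y" if "x \<in> U" "y \<in> U" for x y
    using that l_mult by (simp add: U_def)
  have l1: "l 1 = 0" using lU[OF U1 U1] by simp
  have li: "l (inverse x) = - l x" if "x \<in> U" for x
  proof -
    have "x * inverse x = 1" using that by (simp add: U_def)
    then show ?thesis using lU[OF that Ui[OF that that]] l1 by (simp add: eq_neg_iff_add_eq_0 add.commute)
  qed
  \<comment> \<open>The quotient of two units with equal logarithms has logarithm 0, so
    \<open>l_neg\<close> makes it 1.\<close>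
  have inj: "inj_on l U"
  proof (rule inj_onI)
    fix x y assume xy: "x \<in> U" "y \<in> U" "l x = l y"
    then have "l (x * inverse y) = 0" using lU[OF xy(1) Ui[OF xy(2,2)]] li by simp
    moreover have "x * inverse y \<in> U" using xy by (intro Um Ui)
    ultimately have "x * inverse y = 1" using l_neg[of "x * inverse y"] by (simp add: U_def)
    then show "x = y" using xy(2) by (simp add: U_def field_simps)
  qed
  have Upow: "x ^ n \<in> U" "l (x ^ n) = of_nat n *\<^sub>R l x" if "x \<in> U" for x n
    by (induction n) (auto simp: U1 l1 Um that lU algebra_simps)
  have Upowi: "x powi n \<in> U \<and> l (x powi n) = of_int n *\<^sub>R l x" if "x \<in> U" for x n
  proof (cases "0 \<le> n")
    case True
    then show ?thesis using Upow[OF that, of "nat n"] by (simp add: power_int_def)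
  next
    case False
    then show ?thesis
      using Upow[OF that, of "nat (- n)"] Ui[OF Upow(1) Upow(1), OF that that, of "nat (- n)"]
        li[OF Upow(1), OF that, of "nat (- n)"]
      by (simp add: power_int_def power_inverse)
  qed
  have Uprod: "(\<Prod>i\<in>I. c i powi k i) \<in> U \<and> l (\<Prod>i\<in>I. c i powi k i) = (\<Sum>i\<in>I. of_int (k i) *\<^sub>R l (c i))"
    if "\<And>i. i \<in> I \<Longrightarrow> c i \<in> U" "finite I" for c k and I :: "nat set"
    using that(2,1)
  proof (induction I rule: finite_induct)
    case (insert j I)
    then have "c j powi k j \<in> U" "(\<Prod>i\<in>I. c i powi k i) \<in> U" using Upowi by auto
    then show ?case using insert Upowi[of "c j" "k j"] by (simp add: Um lU)
  qed (simp add: U1 l1)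
  have Ldiff: "x - y \<in> l ` U" if xy: "x \<in> l ` U" "y \<in> l ` U" for x y
  proof -
    from xy obtain a b where "a \<in> U" "b \<in> U" "x = l a" "y = l b" by blast
    then have "x - y = l (a * inverse b)" "a * inverse b \<in> U" using lU Ui li Um by auto
    then show ?thesis by blast
  qed
  have Lfin: "finite {x \<in> l ` U. norm x \<le> R}" for R
    by (rule finite_subset[OF _ finite_imageI[OF l_fin, of l R]]) (auto simp: U_def)
  obtain B where B: "finite B" "B \<subseteq> l ` U" "independent B" "l ` U \<subseteq> range (\<lambda>k. \<Sum>b\<in>B. of_int (k b) *\<^sub>R b)"
    using discrete_subgroup_basis[OF Ldiff Lfin] by blast
  define r where "r = card B"
  obtain b where b: "bij_betw b {..<r} B"
    using ex_bij_betw_nat_finite[OF B(1)] by (auto simp: r_def atLeast0LessThan)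
  define c where "c i = inv_into U l (b i)" for i
  have c: "c i \<in> U" "l (c i) = b i" if "i < r" for i
    using that B(2) bij_betwE[OF b] unfolding c_def
    by (auto intro!: inv_into_into f_inv_into_f)
  have bsum: "(\<Sum>i<r. of_int (k (b i)) *\<^sub>R b i) = (\<Sum>b\<in>B. of_int (k b) *\<^sub>R b)" for k :: "real^'m \<Rightarrow> int"
    using sum.reindex_bij_betw[OF b, of "\<lambda>b. of_int (k b) *\<^sub>R b"] by simp
  have prod: "(\<Prod>i<r. c i powi k i) \<in> U" "l (\<Prod>i<r. c i powi k i) = (\<Sum>i<r. of_int (k i) *\<^sub>R b i)" for k
    using Uprod[of "{..<r}" c k] c by auto
  show ?thesis
  proof (rule that)
    have "card B \<le> CARD('m)" using independent_bound[OF B(3)] by simp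
    \<comment> \<open>A unit with all logarithms negative would be 1 by \<open>l_neg\<close>, but
      the logarithms of 1 are 0.\<close>
    moreover have "card B \<noteq> CARD('m)"
    proof
      assume "card B = CARD('m)"
      then obtain k :: "real^'m \<Rightarrow> int" where k: "\<And>i. (\<Sum>b\<in>B. of_int (k b) *\<^sub>R b) $ i < 0"
        using lattice_meets_negative_orthant[OF B(3)] by blast
      let ?x = "\<Prod>i<r. c i powi k (b i)"
      have x: "?x \<in> U" "\<And>i. l ?x $ i < 0" using prod[of "\<lambda>i. k (b i)"] k bsum by auto
      then have "?x = 1" using l_neg[of ?x] by (simp add: U_def less_imp_le)
      then show False using x(2) l1 by simp
    qed
    ultimately show "r < CARD('m)" by (simp add: r_def)
    show "c i \<in> multiplier_units \<and> 0 < c i" if "i < r" for i using c(1)[OF that] by (simp add: U_def)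
    show "\<exists>k. x = (\<Prod>i<r. c i powi k i)" if x: "x \<in> multiplier_units" "0 < x" for x
    proof -
      have xU: "x \<in> U" using x by (simp add: U_def)
      then obtain k :: "real^'m \<Rightarrow> int" where "l x = (\<Sum>b\<in>B. of_int (k b) *\<^sub>R b)" using B(4) by blast
      then have "l x = l (\<Prod>i<r. c i powi k (b i))" by (simp add: prod bsum)
      then have "x = (\<Prod>i<r. c i powi k (b i))" by (rule inj_onD[OF inj _ xU prod(1)])
      then show ?thesis by (rule exI[of _ "\<lambda>i. k (b i)"])
    qed
    show "k i = k' i" if eq: "(\<Prod>i<r. c i powi k i) = (\<Prod>i<r. c i powi k' i)" and i: "i < r" for i and k k' :: "nat \<Rightarrow> int"
    proof -
      \<comment> \<open>The difference of the exponents, moved from the indices to the basis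
        vectors, where independence of \<open>B\<close> applies.\<close>
      let ?d = "\<lambda>x. real_of_int (k (inv_into {..<r} b x) - k' (inv_into {..<r} b x))"
      have ib: "inv_into {..<r} b (b j) = j" if "j < r" for j
        using that b by (simp add: bij_betw_def)
      have "(\<Sum>x\<in>B. ?d x *\<^sub>R x) = (\<Sum>j<r. ?d (b j) *\<^sub>R b j)"
        by (rule sum.reindex_bij_betw[OF b, symmetric])
      also have "\<dots> = (\<Sum>j<r. of_int (k j) *\<^sub>R b j) - (\<Sum>j<r. of_int (k' j) *\<^sub>R b j)"
        unfolding sum_subtractf[symmetric] by (rule sum.cong) (auto simp: ib algebra_simps)
      also have "\<dots> = 0" using eq prod(2)[of k] prod(2)[of k'] by simp
      finally have "(\<Sum>x\<in>B. ?d x *\<^sub>R x) = 0" .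
      then have "?d (b i) = 0"
        by (rule independentD[OF B(3,1) order_refl, where u = ?d]) (use i bij_betwE[OF b] in blast)
      then show ?thesis using ib[OF i] by simp
    qed
  qed
qed

lemma unit_group_iso:
  obtains r f where "r < CARD('m)"
    "f \<in> iso (integer_mod_group 2 \<times>\<times> product_group {..<r} (\<lambda>_. integer_group)) unit_group"
proof -
  obtain r c where r: "r < CARD('m)" and c: "\<And>i. i < r \<Longrightarrow> c i \<in> multiplier_units \<and> 0 < c i" and
    surj: "\<And>x. x \<in> multiplier_units \<Longrightarrow> 0 < x \<Longrightarrow> \<exists>k. x = (\<Prod>i<r. c i powi k i)" and
    inj: "\<And>i k k'. (\<Prod>i<r. c i powi k i) = (\<Prod>i<r. c i powi k' i) \<Longrightarrow> i < r \<Longrightarrow> k i = k' i"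
    using positive_units_free by blast
  define P where "P k = (\<Prod>i<r. c i powi k i)" for k
  \<comment> \<open>The class 0 of \<open>integer_mod_group 2\<close> gives the sign
    \<open>+\<close>, the class 1 the sign \<open>-\<close>.\<close>
  define f where "f = (\<lambda>(s::int, k). (if s = 0 then 1 else -1) * P k)"
  let ?G = "integer_mod_group 2 \<times>\<times> product_group {..<r} (\<lambda>_. integer_group)"
  have G: "carrier ?G = {0, 1} \<times> (\<Pi>\<^sub>E i\<in>{..<r}. UNIV)"
    by (force simp: carrier_integer_mod_group)
  have units_powi: "x powi n \<in> multiplier_units" if "x \<in> multiplier_units" for x n
    using that by (auto simp: power_int_def units_power units_inverse)
  have "(\<Prod>i\<in>I. c i powi k i) \<in> multiplier_units" if "finite I" "I \<subseteq> {..<r}" for k I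
    using that by (induction I rule: finite_induct) (auto simp: units_1 c intro!: units_mult units_powi)
  then have PU: "P k \<in> multiplier_units" for k unfolding P_def by blast
  have Ppos: "0 < P k" for k unfolding P_def by (rule prod_pos) (auto simp: c)
  have Padd: "P (\<lambda>i\<in>{..<r}. k i + k' i) = P k * P k'" for k k'
    unfolding P_def prod.distrib[symmetric]
    by (rule prod.cong) (use c in \<open>auto simp: power_int_add less_imp_neq[symmetric]\<close>)
  have "f \<in> iso ?G unit_group"
  proof (rule isoI)
    show "f \<in> hom ?G unit_group"
    proof (rule homI)
      fix x assume "x \<in> carrier ?G"
      then show "f x \<in> carrier unit_group" using PU units_minus by (auto simp: f_def unit_group_def)
    next
      fix x y assume xy: "x \<in> carrier ?G" "y \<in> carrier ?G"
      obtain s k s' k' where xy': "x = (s, k)" "y = (s', k')" by (metis surj_pair)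
      have s: "s = 0 \<or> s = 1" "s' = 0 \<or> s' = 1" using xy unfolding G xy' by auto
      have "x \<otimes>\<^bsub>?G\<^esub> y = ((s + s') mod 2, \<lambda>i\<in>{..<r}. k i + k' i)"
        by (simp add: xy' DirProd_def integer_mod_group_def product_group_def)
      then show "f (x \<otimes>\<^bsub>?G\<^esub> y) = f x \<otimes>\<^bsub>unit_group\<^esub> f y"
        using s by (elim disjE) (simp_all add: xy' f_def unit_group_def Padd)
    qed
    show "bij_betw f (carrier ?G) (carrier unit_group)"
      unfolding bij_betw_def
    proof
      show "inj_on f (carrier ?G)"
      proof (rule inj_onI, clarify)
        fix s k s' k' assume x: "(s, k) \<in> carrier ?G" "(s', k') \<in> carrier ?G" and eq: "f (s, k) = f (s', k')"
        have "s = 0 \<or> s = 1" "s' = 0 \<or> s' = 1" using x unfolding G by auto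
        then have "s = s' \<and> P k = P k'"
          using eq Ppos[of k] Ppos[of k'] by (elim disjE) (simp_all add: f_def)
        moreover have "k = k'" if "P k = P k'"
          by (rule PiE_ext[of k "{..<r}" "\<lambda>_. UNIV"]) (use x inj that in \<open>auto simp: G P_def\<close>)
        ultimately show "s = s' \<and> k = k'" by blast
      qed
      show "f ` carrier ?G = carrier unit_group"
      proof (intro equalityI subsetI)
        show "y \<in> carrier unit_group" if "y \<in> f ` carrier ?G" for y
          using that PU units_minus by (auto simp: f_def unit_group_def)
        fix y assume "y \<in> carrier unit_group"
        then have y: "y \<in> multiplier_units" by (simp add: unit_group_def)
        then have "\<bar>y\<bar> \<in> multiplier_units" "0 < \<bar>y\<bar>"
          using units_minus[OF y] units_nonzero[OF y] by (simp_all add: abs_if)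
        then obtain k where k: "\<bar>y\<bar> = P k" using surj unfolding P_def by blast
        \<comment> \<open>Elements of the product group are undefined outside the index set, so the
          exponents have to be restricted.\<close>
        have "P (restrict k {..<r}) = P k" unfolding P_def by (rule prod.cong) auto
        then have "f (if 0 < y then 0 else 1, restrict k {..<r}) = y"
          using k by (auto simp: f_def)
        moreover have "(if 0 < y then 0 else 1, restrict k {..<r}) \<in> carrier ?G" unfolding G by auto
        ultimately show "y \<in> f ` carrier ?G" by (metis imageI)
      qed
    qed
  qed
  then show ?thesis by (rule that[OF r])
qed

end


section \<open>Affine maps modulo a countable dense subgroup\<close>

text \<open>The image is connected, and a connected set with two points is uncountable.\<close>

lemma continuous_countable_image_constant:
  fixes f :: "'a::topological_space \<Rightarrow> 'b::real_normed_vector"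
  assumes "connected S" "continuous_on S f" "countable (f ` S)" "x \<in> S" "y \<in> S"
  shows "f x = f y"
proof (rule ccontr)
  assume "f x \<noteq> f y"
  moreover have "connected (f ` S)" using assms(1,2) by (rule connected_continuous_image[rotated])
  ultimately have "uncountable (f ` S)"
    using connected_uncountable[of "f ` S" "f x" "f y"] assms(4,5) by blast
  then show False using assms(3) by blast
qed

text \<open>An additive map is linear over the rationals. So \<open>f (s x) - s f x\<close>, as a
  function of \<open>s\<close>, is invariant under rational shifts; being small near 0, it is
  arbitrarily small everywhere.\<close>

lemma linear_of_additive_isCont_0:
  fixes f :: "'a::real_normed_vector \<Rightarrow> 'b::real_normed_vector"
  assumes add: "\<And>x y. f (x + y) = f x + f y" and cont: "isCont f 0"
  shows "linear f"
proof (rule linearI)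
  fix t :: real and x
  have zero: "f 0 = 0" using add[of 0 0] by simp
  have neg: "f (- y) = - f y" for y using add[of y "- y"] zero by (simp add: eq_neg_iff_add_eq_0 add.commute)
  have nat: "f (of_nat n *\<^sub>R y) = of_nat n *\<^sub>R f y" for n y
    by (induction n) (simp_all add: zero add algebra_simps)
  have int: "f (of_int n *\<^sub>R y) = of_int n *\<^sub>R f y" for n y
  proof (cases n)
    case (nonneg m)
    then show ?thesis using nat[of m y] by simp
  next
    case (neg m)
    then show ?thesis using nat[of "Suc m" y] \<open>\<And>y. f (- y) = - f y\<close>[of "of_nat (Suc m) *\<^sub>R y"] by (simp del: of_nat_Suc)
  qed
  have rat: "f (r *\<^sub>R x) = r *\<^sub>R f x" if "r \<in> \<rat>" for r
  proof -
    obtain a b :: int where b: "b > 0" "r = of_int a / of_int b"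
      using \<open>r \<in> \<rat>\<close> by (rule Rats_cases') auto
    have "of_int b *\<^sub>R f (r *\<^sub>R x) = f (of_int a *\<^sub>R x)" using b int[of b "r *\<^sub>R x"] by simp
    also have "\<dots> = of_int b *\<^sub>R (r *\<^sub>R f x)" using b int[of a x] by simp
    finally show ?thesis using b(1) by (simp del: scaleR_scaleR)
  qed
  define k where "k s = f (s *\<^sub>R x) - s *\<^sub>R f x" for s
  have "isCont k 0"
    unfolding k_def by (intro continuous_intros isCont_o2[where g = f and f = "\<lambda>s. s *\<^sub>R x"]) (simp add: cont)
  have shift: "k t = k (t - r)" if "r \<in> \<rat>" for r
  proof -
    have "f (t *\<^sub>R x) = f ((t - r) *\<^sub>R x) + f (r *\<^sub>R x)"
      unfolding add[symmetric] by (simp add: algebra_simps)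
    then show ?thesis using rat[OF that] by (simp add: k_def algebra_simps)
  qed
  have "norm (k t) < e" if "e > 0" for e
  proof -
    obtain d where d: "d > 0" "\<And>s. norm s < d \<Longrightarrow> norm (k s) < e"
      using \<open>isCont k 0\<close> \<open>e > 0\<close> unfolding continuous_at_eps_delta
      by (auto simp: k_def zero dist_norm)
    obtain r where r: "r \<in> \<rat>" "t - d < r" "r < t" using Rats_dense_in_real[of "t - d" t] d(1) by auto
    then show ?thesis using d(2)[of "t - r"] shift[OF r(1)] by simp
  qed
  then have "k t = 0" by (metis less_irrefl zero_less_norm_iff)
  then show "f (t *\<^sub>R x) = t *\<^sub>R f x" by (simp add: k_def)
qed (rule add)

text \<open>The global map is \<open>2^n F(x / 2^n)\<close> for \<open>n\<close> so large that
  \<open>x / 2^n\<close> lies in the ball. Additivity at two equal arguments shows that larger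
  \<open>n\<close> give the same value.\<close>

lemma linear_of_locally_additive:
  fixes F :: "'a::real_normed_vector \<Rightarrow> 'b::real_normed_vector"
  assumes d: "0 < d" and cont: "continuous_on (ball 0 d) F"
    and add: "\<And>x y. norm x < d \<Longrightarrow> norm y < d \<Longrightarrow> F (x + y) = F x + F y"
  shows "\<exists>L. linear L \<and> (\<forall>x. norm x < d \<longrightarrow> F x = L x)"
proof -
  define s where "s n x = 2 ^ n *\<^sub>R F ((1 / 2 ^ n) *\<^sub>R x)" for n :: nat and x
  have small: "norm ((1 / 2 ^ m) *\<^sub>R x) < d" if "norm x < d * 2 ^ n" "n \<le> m" for n m x
  proof -
    have "norm x < d * 2 ^ m" using that d by (smt (verit) mult_left_mono power_increasing)
    then show ?thesis by (simp add: field_simps)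
  qed
  have dbl: "s (Suc n) x = s n x" if "norm ((1 / 2 ^ Suc n) *\<^sub>R x) < d" for n x
    using add[OF that that] by (simp add: s_def scaleR_2[symmetric] flip: scaleR_left.add) 
  have stable: "s m x = s n x" if "n \<le> m" "norm x < d * 2 ^ n" for n m x
    using that(1)
  proof (induction m rule: dec_induct)
    case (step m)
    then show ?case using dbl[of m x] small[of x n "Suc m"] that(2) by simp
  qed simp
  have ex: "\<exists>n. norm x < d * 2 ^ n" for x
  proof -
    obtain n where "norm x / d < 2 ^ n" using real_arch_pow[of 2 "norm x / d"] by auto
    then show ?thesis using d by (auto simp: field_simps)
  qed
  define N where "N x = (SOME n. norm x < d * 2 ^ n)" for x :: 'a
  have N: "norm x < d * 2 ^ N x" for x unfolding N_def using ex by (rule someI_ex)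
  define L where "L x = s (N x) x" for x
  have L: "L x = s m x" if "N x \<le> m" for x m
    unfolding L_def using stable[OF that N] by simp
  have LF: "L x = F x" if "norm x < d" for x
    using stable[of 0 "N x" x] that by (simp add: L_def s_def)
  have "linear L"
  proof (rule linear_of_additive_isCont_0)
    fix x y
    \<comment> \<open>One scale at which all three arguments are small enough.\<close>
    define m where "m = Max {N x, N y, N (x + y)}"
    have m: "N x \<le> m" "N y \<le> m" "N (x + y) \<le> m" by (auto simp: m_def)
    have "s m (x + y) = s m x + s m y"
      using add[OF small[OF N m(1)] small[OF N m(2)]] by (simp add: s_def scaleR_add_right)
    then show "L (x + y) = L x + L y" using m by (simp add: L)
  next
    have "isCont F 0" using cont d by (simp add: continuous_on_eq_continuous_at)
    moreover have "\<forall>\<^sub>F x in nhds 0. L x = F x"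
      unfolding eventually_nhds_metric using d LF by (auto intro!: exI[of _ d])
    ultimately show "isCont L 0" using isCont_cong by blast
  qed
  then show ?thesis using LF by auto
qed

locale countable_dense_subgroup =
  fixes \<Gamma> :: "'a::euclidean_space set"
  assumes zero: "0 \<in> \<Gamma>" and diff: "x \<in> \<Gamma> \<Longrightarrow> y \<in> \<Gamma> \<Longrightarrow> x - y \<in> \<Gamma>"
    and countable: "countable \<Gamma>" and dense: "open W \<Longrightarrow> W \<noteq> {} \<Longrightarrow> W \<inter> \<Gamma> \<noteq> {}"
begin

lemma neg: "x \<in> \<Gamma> \<Longrightarrow> - x \<in> \<Gamma>"
  using diff[OF zero] by simp

lemma add: "x \<in> \<Gamma> \<Longrightarrow> y \<in> \<Gamma> \<Longrightarrow> x + y \<in> \<Gamma>"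
  using diff[OF _ neg, of x y] by simp

lemma approx:
  assumes "0 < e" obtains y where "y \<in> \<Gamma>" "norm (x - y) < e"
  using dense[of "ball x e"] assms by (auto simp: dist_norm)

lemma locally_affine:
  fixes g :: "'a \<Rightarrow> 'a"
  assumes e: "0 < e" and cont: "continuous_on (ball 0 e) g"
    and equi: "\<And>x y. norm x < e \<Longrightarrow> norm y < e \<Longrightarrow> x - y \<in> \<Gamma> \<Longrightarrow> g x - g y \<in> \<Gamma>"
  obtains L d where "linear L" "0 < d" "d \<le> e" "\<And>x. norm x < d \<Longrightarrow> g x = L x + g 0"
proof -
  \<comment> \<open>Half the radius, so that the sum of two vectors shorter than \<open>d\<close>
    stays in the domain of \<open>g\<close>.\<close>
  define d where "d = e / 2"
  have d: "0 < d" "d \<le> e" using e by (auto simp: d_def)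
  have sub: "norm (x + y) < e" if "norm x < d" "norm y < d" for x y :: 'a
    using norm_triangle_ineq[of x y] that by (simp add: d_def)
  have contd: "continuous_on (ball 0 d) (\<lambda>x. g (x + y))" if "norm y < d" for y
    by (rule continuous_on_compose2[OF cont]) (use sub that in \<open>auto intro!: continuous_intros\<close>)
  have gam: "g (x + y) - g x = g y - g 0" if x: "norm x < d" and y: "y \<in> \<Gamma>" "norm y < d" for x y
  proof -
    let ?f = "\<lambda>x. g (x + y) - g x"
    have "?f x = ?f 0"
    proof (rule continuous_countable_image_constant[where f = ?f and S = "ball 0 d"])
      show "connected (ball (0::'a) d)" by simp
      show "continuous_on (ball 0 d) ?f"
        using contd[OF y(2)] continuous_on_subset[OF cont subset_ball[OF d(2)]]
        by (rule continuous_on_diff)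
      show "countable (?f ` ball 0 d)"
        by (rule countable_subset[OF _ countable]) (use equi sub y d in auto)
    qed (use x d in auto)
    then show ?thesis by simp
  qed
  have F: "g (x + y) - g x = g y - g 0" if x: "norm x < d" and y: "norm y < d" for x y
  proof (rule ccontr)
    \<comment> \<open>By \<open>gam\<close> this vanishes at the small elements of
      \<open>\<Gamma>\<close>. The set where it does not vanish is open, so by density it would
      contain one of them if it were nonempty.\<close>
    let ?k = "\<lambda>y. g (y + x) - g x - g y + g 0"
    assume "g (x + y) - g x \<noteq> g y - g 0"
    then have "y \<in> ball 0 d \<inter> ?k -` (- {0})" using y by (auto simp: algebra_simps)
    moreover have "open (ball 0 d \<inter> ?k -` (- {0}))"
    proof (rule continuous_open_preimage)
      show "continuous_on (ball 0 d) ?k"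
        using contd[OF x] continuous_on_subset[OF cont subset_ball[OF d(2)]]
        by (intro continuous_intros)
    qed auto
    ultimately obtain z where "z \<in> \<Gamma>" "norm z < d" "?k z \<noteq> 0" using dense by fastforce
    then show False using gam[OF x] by (simp add: algebra_simps)
  qed
  have "\<exists>L. linear L \<and> (\<forall>x. norm x < d \<longrightarrow> g x - g 0 = L x)"
  proof (rule linear_of_locally_additive[OF d(1)])
    show "continuous_on (ball 0 d) (\<lambda>x. g x - g 0)"
      using continuous_on_subset[OF cont subset_ball[OF d(2)]] by (intro continuous_intros)
    show "g (x + y) - g 0 = g x - g 0 + (g y - g 0)" if "norm x < d" "norm y < d" for x y
      using F[OF that] by (simp add: algebra_simps)
  qed
  then show ?thesis using that d by (metis diff_add_cancel)
qed

text \<open>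
  A dense subgroup is generated by its elements of norm less than \<open>d\<close>.
\<close>

lemma preserved_if_small_preserved:
  assumes L: "linear L" and d: "0 < d" and small: "\<And>x. x \<in> \<Gamma> \<Longrightarrow> norm x < d \<Longrightarrow> L x \<in> \<Gamma>"
    and x: "x \<in> \<Gamma>"
  shows "L x \<in> \<Gamma>"
proof -
  have nat: "of_nat n *\<^sub>R y \<in> \<Gamma>" if "y \<in> \<Gamma>" for n y
    by (induction n) (use zero add that in \<open>auto simp: algebra_simps\<close>)
  \<comment> \<open>\<open>N\<close> makes \<open>x / N\<close> shorter than \<open>d / 2\<close>.
    If \<open>y\<close> is close to \<open>x / N\<close>, both \<open>y\<close> and
    \<open>x - N y\<close> are shorter than \<open>d\<close>, and \<open>x\<close> is the second
    plus a multiple of the first.\<close>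
  obtain N :: nat where N: "2 * norm x / d < of_nat N" using reals_Archimedean2 by blast
  then have N0: "0 < real N" using d by (smt (verit) divide_nonneg_pos norm_ge_zero)
  obtain y where y: "y \<in> \<Gamma>" "norm ((1 / of_nat N) *\<^sub>R x - y) < d / (2 * of_nat N)"
    using approx[of "d / (2 * of_nat N)"] d N0 by auto
  have "norm (x - of_nat N *\<^sub>R y) = of_nat N * norm ((1 / of_nat N) *\<^sub>R x - y)"
  proof -
    have "x - of_nat N *\<^sub>R y = of_nat N *\<^sub>R ((1 / of_nat N) *\<^sub>R x - y)"
      using N0 by (simp add: scaleR_diff_right)
    then show ?thesis by (metis norm_scaleR abs_of_nat)
  qed
  also have "\<dots> < d" using y(2) N0 d by (simp add: field_simps)
  finally have "L (x - of_nat N *\<^sub>R y) \<in> \<Gamma>" using x y(1) by (intro small diff nat)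
  moreover have "L y \<in> \<Gamma>"
  proof (rule small[OF y(1)])
    have "norm y \<le> norm ((1 / of_nat N) *\<^sub>R x) + norm ((1 / of_nat N) *\<^sub>R x - y)"
      by (metis norm_minus_commute norm_triangle_sub)
    also have "norm ((1 / of_nat N) *\<^sub>R x) < d / 2" using N N0 d by (simp add: field_simps)
    also have "norm ((1 / of_nat N) *\<^sub>R x - y) < d / 2"
    proof -
      have "1 \<le> real N" using N0 by simp
      then have "d / (2 * real N) \<le> d / 2" using d by (simp add: field_simps)
      then show ?thesis using y(2) by linarith
    qed
    finally show "norm y < d" by simp
  qed
  then have "of_nat N *\<^sub>R L y \<in> \<Gamma>" by (rule nat)
  ultimately have "L (x - of_nat N *\<^sub>R y) + of_nat N *\<^sub>R L y \<in> \<Gamma>" by (rule add)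
  then show ?thesis by (simp add: linear_diff[OF L] linear_scale[OF L])
qed

text \<open>The difference is continuous with values in the countable \<open>\<Gamma>\<close>, hence
  constant. So an affine lift is unique up to a translation by \<open>\<Gamma>\<close>.\<close>

lemma affine_cong_unique:
  fixes L L' :: "'a \<Rightarrow> 'a"
  assumes "linear L" "linear L'" "\<And>x. L x + b - (L' x + b') \<in> \<Gamma>"
  shows "L = L'" "b - b' \<in> \<Gamma>"
proof
  fix x
  let ?f = "\<lambda>x. L x + b - (L' x + b')"
  have "?f x = ?f 0"
  proof (rule continuous_countable_image_constant[where f = ?f and S = UNIV])
    show "continuous_on UNIV ?f"
      by (intro continuous_intros linear_continuous_on) (use assms linear_conv_bounded_linear in blast)+
    show "countable (range ?f)" by (rule countable_subset[OF _ countable]) (use assms in auto)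
  qed auto
  then show "L x = L' x" using assms(1,2) by (simp add: linear_0)
  show "b - b' \<in> \<Gamma>" using assms(3)[of 0] assms(1,2) by (simp add: linear_0)
qed

end


section \<open>Smooth maps and quotient diffeologies\<close>

lemma C_k_on_const: "C_k_on k p U (\<lambda>u. c)"
proof (induction k arbitrary: c)
  case (Suc k)
  have "\<exists>g. (\<forall>u\<in>U. ((\<lambda>t. c) has_vector_derivative g u) (at (u i))) \<and> C_k_on k p U g" for i
    by (rule exI[of _ "\<lambda>u. 0"]) (simp add: Suc)
  then show ?case by simp
qed simp

text \<open>The partial derivatives have the same shape, with the derivative of \<open>f\<close> in
  place of \<open>f\<close> and with \<open>b = 0\<close>; this is why \<open>f\<close> and
  \<open>b\<close> vary in the induction.\<close>

lemma C_k_on_affine: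
  fixes L :: "'a::real_normed_vector \<Rightarrow> 'b::real_normed_vector"
  assumes L: "bounded_linear L" and f: "C_k_on k p U f"
  shows "C_k_on k p U (\<lambda>u. L (f u) + b)"
  using f
proof (induction k arbitrary: f b)
  case 0
  have "continuous_on UNIV (\<lambda>x. L x + b)"
    by (intro continuous_intros linear_continuous_on L)
  then have "continuous_map euclidean euclidean (\<lambda>x. L x + b)" by simp
  from continuous_map_compose[OF _ this] 0 show ?case by (auto simp: o_def)
next
  case (Suc k)
  have "continuous_on UNIV (\<lambda>x. L x + b)"
    by (intro continuous_intros linear_continuous_on L)
  then have "continuous_map euclidean euclidean (\<lambda>x. L x + b)" by simp
  from continuous_map_compose[OF _ this] Suc.prems
  have c: "continuous_map (subtopology (Euclidean_space p) U) euclidean (\<lambda>u. L (f u) + b)"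
    by (auto simp: o_def)
  have "\<exists>h. (\<forall>u\<in>U. ((\<lambda>t. L (f (u(i := t))) + b) has_vector_derivative h u) (at (u i))) \<and> C_k_on k p U h"
    if i: "i < p" for i
  proof -
    obtain g where g: "\<forall>u\<in>U. ((\<lambda>t. f (u(i := t))) has_vector_derivative g u) (at (u i))" "C_k_on k p U g"
      using Suc.prems i unfolding C_k_on.simps by blast
    have "((\<lambda>t. L (f (u(i := t))) + b) has_vector_derivative L (g u) + 0) (at (u i))" if "u \<in> U" for u
      by (intro has_vector_derivative_add bounded_linear.has_vector_derivative[OF L] g(1)[rule_format] that
          has_vector_derivative_const)
    then show ?thesis using Suc.IH[OF g(2), of 0] by (intro exI[of _ "\<lambda>u. L (g u) + 0"]) auto
  qed
  then show ?case using c by simp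
qed

lemma C_infinity_on_affine:
  "bounded_linear L \<Longrightarrow> C_infinity_on p U f \<Longrightarrow> C_infinity_on p U (\<lambda>u. L (f u) + b)"
  by (simp add: C_infinity_on_def C_k_on_affine)

lemma continuous_map_linear_combination:
  "continuous_map (subtopology (Euclidean_space p) U) euclidean (\<lambda>u. \<Sum>i<p. u i *\<^sub>R (b i :: 'a::real_normed_vector))"
proof -
  have "continuous_on (topspace (Euclidean_space p)) (\<lambda>u. \<Sum>i<p. u i *\<^sub>R b i)"
    by (intro continuous_intros continuous_on_subset[OF continuous_on_product_coordinates]) auto
  then show ?thesis
    by (simp add: continuous_map_Euclidean_space_iff[symmetric] continuous_map_from_subtopology)
qed

text \<open>With \<open>b\<close> a basis, this is the linear chart from the function model of
  \<open>\<real>^p\<close> to a Euclidean type. Its partial derivatives are constant.\<close>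

lemma C_infinity_on_linear_combination:
  "C_infinity_on p U (\<lambda>u. \<Sum>i<p. u i *\<^sub>R (b i :: 'a::real_normed_vector))"
  unfolding C_infinity_on_def
proof
  fix k
  have "\<exists>g. (\<forall>u\<in>U. ((\<lambda>t. \<Sum>j<p. (u(i := t)) j *\<^sub>R b j) has_vector_derivative g u) (at (u i))) \<and> C_k_on k p U g"
    if "i < p" for i k
  proof (intro exI conjI ballI)
    show "C_k_on k p U (\<lambda>u. b i)" by (rule C_k_on_const)
    fix u
    have "((\<lambda>t. \<Sum>j<p. (u(i := t)) j *\<^sub>R b j) has_vector_derivative (\<Sum>j<p. if j = i then b i else 0)) (at (u i))"
    proof (rule has_vector_derivative_sum)
      fix j
      have "((\<lambda>t. t *\<^sub>R b i) has_vector_derivative 1 *\<^sub>R b i) (at (u i))"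
        using has_vector_derivative_scaleR[OF DERIV_ident has_vector_derivative_const[of "b i"]] by simp
      then show "((\<lambda>t. (u(i := t)) j *\<^sub>R b j) has_vector_derivative (if j = i then b i else 0)) (at (u i))"
        by (cases "j = i") simp_all
    qed
    then show "((\<lambda>t. \<Sum>j<p. (u(i := t)) j *\<^sub>R b j) has_vector_derivative b i) (at (u i))"
      using that by simp
  qed
  then show "C_k_on k p U (\<lambda>u. \<Sum>i<p. u i *\<^sub>R b i)"
    by (cases k) (simp_all add: continuous_map_linear_combination)
qed

section \<open>Quotients of Euclidean spaces\<close>

lemma points_quotient_standard: "points (quotient_diffeology standard_diffeology q) = range q"
  by (simp add: quotient_diffeology_def standard_diffeology_def)

lemma plot_quotient_standard:
  "plot (quotient_diffeology standard_diffeology q) p U f \<longleftrightarrow> openin (Euclidean_space p) U \<and>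
     (\<forall>u\<in>U. \<exists>V g. u \<in> V \<and> V \<subseteq> U \<and> openin (Euclidean_space p) V \<and> C_infinity_on p V g \<and> (\<forall>v\<in>V. f v = q (g v)))"
  by (simp add: quotient_diffeology_def standard_diffeology_def conj_assoc)

lemma differentiable_map_affine:
  fixes q :: "'a::euclidean_space \<Rightarrow> 'b" and q' :: "'c::euclidean_space \<Rightarrow> 'd"
  assumes L: "linear L" and h: "\<And>x. h (q x) = q' (L x + b)"
  shows "differentiable_map (quotient_diffeology standard_diffeology q) (quotient_diffeology standard_diffeology q') h"
  unfolding differentiable_map_def points_quotient_standard plot_quotient_standard
proof (intro conjI allI impI ballI)
  show "h ` range q \<subseteq> range q'" using h by auto
next
  fix p U f u
  assume f: "openin (Euclidean_space p) U \<and> (\<forall>u\<in>U. \<exists>V g. u \<in> V \<and> V \<subseteq> U \<and>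
    openin (Euclidean_space p) V \<and> C_infinity_on p V g \<and> (\<forall>v\<in>V. f v = q (g v)))"
  then show "openin (Euclidean_space p) U" by blast
  assume "u \<in> U"
  with f obtain V g where V: "u \<in> V" "V \<subseteq> U" "openin (Euclidean_space p) V" "C_infinity_on p V g" "\<forall>v\<in>V. f v = q (g v)"
    by blast
  have "C_infinity_on p V (\<lambda>u. L (g u) + b)"
    using L V(4) by (intro C_infinity_on_affine) (simp_all add: linear_conv_bounded_linear)
  then show "\<exists>V g. u \<in> V \<and> V \<subseteq> U \<and> openin (Euclidean_space p) V \<and> C_infinity_on p V g \<and> (\<forall>v\<in>V. (h \<circ> f) v = q' (g v))"
    using V h by (intro exI[of _ V] exI[of _ "\<lambda>u. L (g u) + b"]) simp
qed

text \<open>Composing \<open>q\<close> with a linear chart \<open>F\<close> gives a plot defined on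
  the whole space. Its image under \<open>h\<close> is a plot, hence lifts near the point over 0,
  and the inverse chart \<open>D\<close> carries the lift back to the type \<open>'a\<close>. Only
  continuity of the lift is kept.\<close>

lemma differentiable_map_local_lift:
  fixes q :: "'a::euclidean_space \<Rightarrow> 'b" and q' :: "'c::euclidean_space \<Rightarrow> 'd"
  assumes h: "differentiable_map (quotient_diffeology standard_diffeology q) (quotient_diffeology standard_diffeology q') h"
  obtains e g where "0 < e" "continuous_on (ball 0 e) g" "\<And>x. norm x < e \<Longrightarrow> h (q x) = q' (g x)"
proof -
  let ?n = "DIM('a)" and ?E = "Euclidean_space DIM('a)"
  obtain b :: "nat \<Rightarrow> 'a" where b: "bij_betw b {..<?n} Basis"
    using ex_bij_betw_nat_finite[OF finite_Basis] by (auto simp: atLeast0LessThan)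
  define F where "F u = (\<Sum>i<?n. u i *\<^sub>R b i)" for u
  \<comment> \<open>Coordinates beyond the dimension are 0, as membership in
    \<open>Euclidean_space\<close> demands.\<close>
  define D where "D x i = (if i < ?n then x \<bullet> b i else 0)" for x i
  have FD: "F (D x) = x" for x
  proof -
    have "F (D x) = (\<Sum>i<?n. (x \<bullet> b i) *\<^sub>R b i)" by (simp add: F_def D_def)
    also have "\<dots> = (\<Sum>b\<in>Basis. (x \<bullet> b) *\<^sub>R b)" by (rule sum.reindex_bij_betw[OF b])
    finally show ?thesis by (simp add: euclidean_representation)
  qed
  have contD: "continuous_map euclidean ?E D"
    unfolding D_def[abs_def] continuous_map_componentwise_Euclidean_space
    by (auto intro!: continuous_intros)
  let ?U = "topspace ?E"
  have "plot (quotient_diffeology standard_diffeology q) ?n ?U (q \<circ> F)"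
    unfolding plot_quotient_standard F_def
    using C_infinity_on_linear_combination[of ?n ?U b] by (auto intro!: exI[of _ ?U])
  then have "plot (quotient_diffeology standard_diffeology q') ?n ?U (h \<circ> (q \<circ> F))"
    using h by (simp add: differentiable_map_def)
  moreover have D0: "D 0 \<in> ?U" by (simp add: topspace_Euclidean_space D_def)
  ultimately obtain V g where V: "D 0 \<in> V" "openin ?E V" "C_infinity_on ?n V g" "\<And>v. v \<in> V \<Longrightarrow> h (q (F v)) = q' (g v)"
    unfolding plot_quotient_standard by auto
  have "openin euclidean {x \<in> topspace euclidean. D x \<in> V}"
    by (rule openin_continuous_map_preimage[OF contD V(2)])
  then have "open {x. D x \<in> V}" by simp
  then obtain e where e: "0 < e" "ball 0 e \<subseteq> {x. D x \<in> V}" using V(1) openE by blast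
  have "continuous_map (subtopology ?E V) euclidean g"
    using V(3) by (metis C_infinity_on_def C_k_on.simps(1))
  moreover have "continuous_map (top_of_set (ball 0 e)) (subtopology ?E V) D"
    using continuous_map_from_subtopology[OF contD] e(2) by (auto simp: continuous_map_in_subtopology)
  ultimately have "continuous_map (top_of_set (ball 0 e)) euclidean (g \<circ> D)"
    by (rule continuous_map_compose[rotated])
  then have "continuous_on (ball 0 e) (g \<circ> D)" by simp
  moreover have "h (q x) = q' ((g \<circ> D) x)" if "norm x < e" for x
    using V(4)[of "D x"] e(2) that by (auto simp: FD)
  ultimately show ?thesis using that e(1) by blast
qed

text \<open>Both \<open>h\<close> and its inverse are covered by the identity of the space
  upstairs.\<close>

lemma diffeomorphism_same_fibres:
  fixes q :: "'a::euclidean_space \<Rightarrow> 'b" and q' :: "'a \<Rightarrow> 'd"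
  assumes h: "\<And>x. h (q x) = q' x" and fib: "\<And>x y. q x = q y \<longleftrightarrow> q' x = q' y"
  shows "diffeomorphism (quotient_diffeology standard_diffeology q) (quotient_diffeology standard_diffeology q') h"
  unfolding diffeomorphism_def points_quotient_standard
proof (intro conjI)
  have inj: "inj_on h (range q)" using h fib by (auto intro!: inj_onI)
  show "bij_betw h (range q) (range q')"
    unfolding bij_betw_def using inj h by (auto simp: image_image)
  show "differentiable_map (quotient_diffeology standard_diffeology q) (quotient_diffeology standard_diffeology q') h"
    by (rule differentiable_map_affine[where L = id and b = 0]) (simp_all add: h linear_id)
  show "differentiable_map (quotient_diffeology standard_diffeology q') (quotient_diffeology standard_diffeology q)
     (inv_into (range q) h)"
    by (rule differentiable_map_affine[where L = id and b = 0])
       (simp_all add: h[symmetric] inv_into_f_f[OF inj] linear_id)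
qed

section \<open>Diffeomorphisms of the quotient by a countable dense subgroup\<close>

locale dense_quotient = countable_dense_subgroup +
  fixes q :: "'a::euclidean_space \<Rightarrow> 'b"
  assumes q_eq_iff: "q x = q y \<longleftrightarrow> x - y \<in> \<Gamma>"
begin

abbreviation Q where "Q \<equiv> quotient_diffeology standard_diffeology q"

text \<open>A local lift at 0 is affine. Its linear part maps small elements of
  \<open>\<Gamma>\<close> into \<open>\<Gamma>\<close>, because they have the same class as 0, and
  then all of \<open>\<Gamma>\<close>.\<close>

lemma differentiable_imp_affine:
  assumes "differentiable_map Q Q h"
  obtains L b where "linear L" "L ` \<Gamma> \<subseteq> \<Gamma>" "\<And>x. h (q x) = q (L x + b)"
proof -
  obtain e g where e: "0 < e" "continuous_on (ball 0 e) g" "\<And>x. norm x < e \<Longrightarrow> h (q x) = q (g x)"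
    using differentiable_map_local_lift[OF assms] by blast
  have "g x - g y \<in> \<Gamma>" if "norm x < e" "norm y < e" "x - y \<in> \<Gamma>" for x y
    using e(3)[OF that(1)] e(3)[OF that(2)] that(3) q_eq_iff by metis
  then obtain L d where L: "linear L" "0 < d" "d \<le> e" "\<And>x. norm x < d \<Longrightarrow> g x = L x + g 0"
    using locally_affine[OF e(1,2)] by blast
  have h: "h (q x) = q (L x + g 0)" if "norm x < d" for x using e(3)[of x] L(3) L(4)[OF that] that by simp
  have small: "L x \<in> \<Gamma>" if "x \<in> \<Gamma>" "norm x < d" for x
  proof -
    have "q x = q 0" using that(1) by (simp add: q_eq_iff)
    then have "q (L x + g 0) = q (L 0 + g 0)" using h[OF that(2)] h[of 0] L(2) by simp
    then show ?thesis by (simp add: q_eq_iff linear_0[OF L(1)])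
  qed
  have pres: "L x \<in> \<Gamma>" if "x \<in> \<Gamma>" for x
    by (rule preserved_if_small_preserved[OF L(1,2) small that])
  show ?thesis
  proof (rule that[OF L(1)])
    show "L ` \<Gamma> \<subseteq> \<Gamma>" using pres by blast
    fix x
    \<comment> \<open>By density every class has a representative in the ball where the formula for
      \<open>h\<close> is already known.\<close>
    obtain y where y: "y \<in> \<Gamma>" "norm (x - y) < d" using approx[OF L(2)] by blast
    have "q x = q (x - y)" using y(1) by (simp add: q_eq_iff)
    then have "h (q x) = q (L (x - y) + g 0)" using h[OF y(2)] by simp
    also have "\<dots> = q (L x + g 0)"
      using pres[OF y(1)] by (simp add: q_eq_iff linear_diff[OF L(1)] neg)
    finally show "h (q x) = q (L x + g 0)" .
  qed
qed

text \<open>The map and its inverse both have affine lifts; the two composites lift the identity, so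
  by uniqueness of lifts the linear parts are inverse to each other.\<close>

lemma diffeomorphism_imp_affine:
  assumes h: "diffeomorphism Q Q h"
  obtains L b where "linear L" "bij L" "L ` \<Gamma> = \<Gamma>" "\<And>x. h (q x) = q (L x + b)"
proof -
  have bij: "bij_betw h (range q) (range q)"
    using h by (simp add: diffeomorphism_def points_quotient_standard)
  let ?h' = "inv_into (range q) h"
  obtain L b where L: "linear L" "L ` \<Gamma> \<subseteq> \<Gamma>" "\<And>x. h (q x) = q (L x + b)"
    using differentiable_imp_affine h unfolding diffeomorphism_def by metis
  obtain M c where M: "linear M" "M ` \<Gamma> \<subseteq> \<Gamma>" "\<And>x. ?h' (q x) = q (M x + c)"
    using differentiable_imp_affine h unfolding diffeomorphism_def points_quotient_standard by metis
  have "q (M (L x) + (M b + c)) = q (x + 0)" for x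
    using bij_betw_inv_into_left[OF bij, of "q x"] L(3)[of x] M(3)[of "L x + b"]
    by (simp add: linear_add[OF M(1)] add.assoc)
  then have "M \<circ> L = id"
    by (intro affine_cong_unique(1)[of "M \<circ> L" id "M b + c" 0] linear_compose L M linear_id)
       (simp add: q_eq_iff)
  have "q (L (M x) + (L c + b)) = q (x + 0)" for x
    using bij_betw_inv_into_right[OF bij, of "q x"] M(3)[of x] L(3)[of "M x + c"]
    by (simp add: linear_add[OF L(1)] add.assoc)
  then have "L \<circ> M = id"
    by (intro affine_cong_unique(1)[of "L \<circ> M" id "L c + b" 0] linear_compose L M linear_id)
       (simp add: q_eq_iff)
  show ?thesis
  proof (rule that[OF L(1) _ _ L(3)])
    show "bij L" using \<open>M \<circ> L = id\<close> \<open>L \<circ> M = id\<close> by (rule o_bij)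
    have "x \<in> L ` \<Gamma>" if "x \<in> \<Gamma>" for x
      using that M(2) \<open>L \<circ> M = id\<close> by (auto simp: fun_eq_iff intro!: image_eqI[of x L "M x"])
    then show "L ` \<Gamma> = \<Gamma>" using L(2) by blast
  qed
qed

text \<open>The inverse is covered by the affine map \<open>M x - M b\<close>, where
  \<open>M\<close> is the inverse of \<open>L\<close>.\<close>

lemma affine_diffeomorphism:
  assumes L: "linear L" "bij L" "L ` \<Gamma> = \<Gamma>" and h: "\<And>x. h (q x) = q (L x + b)"
  shows "diffeomorphism Q Q h"
proof -
  obtain M where M: "linear M" "M \<circ> L = id"
    using linear_injective_left_inverse[OF L(1)] L(2) bij_is_inj by blast
  have left: "M (L x) = x" for x using M(2) by (metis comp_apply id_apply)
  have right: "L (M x) = x" for x using left L(2) by (metis bij_pointE)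
  have inG: "L x \<in> \<Gamma> \<longleftrightarrow> x \<in> \<Gamma>" for x using L(3) left by (metis imageE imageI)
  have inj: "inj_on h (range q)"
    by (auto intro!: inj_onI simp: h q_eq_iff linear_diff[OF L(1), symmetric] inG)
  have hM: "h (q (M x + - M b)) = q x" for x
    by (simp add: h linear_diff[OF L(1)] right)
  have "inv_into (range q) h (q x) = q (M x + - M b)" for x
    using inv_into_f_f[OF inj, of "q (M x + - M b)"] unfolding hM by simp
  moreover have "h ` range q = range q"
    using h hM by (auto, metis rangeI image_eqI)
  ultimately show ?thesis
    unfolding diffeomorphism_def points_quotient_standard bij_betw_def
    using inj differentiable_map_affine[OF L(1), of h q q b] h
      differentiable_map_affine[OF M(1), of "inv_into (range q) h" q q "- M b"] by blast
qed

end


section \<open>Leaves of a linear flow\<close>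

lemma integer_lattice_diff: "x \<in> integer_lattice \<Longrightarrow> y \<in> integer_lattice \<Longrightarrow> x - y \<in> integer_lattice"
  by (auto simp: integer_lattice_def)

lemma integer_lattice_zero: "0 \<in> integer_lattice"
  by (auto simp: integer_lattice_def zero_prod_def)

lemma mem_torus_proj: "w \<in> torus_proj z \<longleftrightarrow> w - z \<in> integer_lattice"
  by (force simp: torus_proj_def r_coset_def additive_group_def intro!: bexI[of _ "w - z"])

lemma torus_proj_eq_iff: "torus_proj z = torus_proj z' \<longleftrightarrow> z - z' \<in> integer_lattice"
proof
  assume "torus_proj z = torus_proj z'"
  then show "z - z' \<in> integer_lattice"
    using mem_torus_proj[of z z] integer_lattice_zero by (simp add: mem_torus_proj)
next
  assume d: "z - z' \<in> integer_lattice"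
  have "w - z \<in> integer_lattice \<longleftrightarrow> w - z' \<in> integer_lattice" for w
    using integer_lattice_diff[of "w - z'" "z - z'"] integer_lattice_diff[of "w - z" "z' - z"]
      integer_lattice_diff[OF integer_lattice_zero d] d by auto
  then show "torus_proj z = torus_proj z'" by (auto simp: mem_torus_proj)
qed

lemma flow_form_linear: "linear (flow_form \<alpha>)"
  by (rule linearI) (auto simp: flow_form_def algebra_simps split: prod.splits)

lemma flow_form_0_right [simp]: "flow_form \<alpha> (0, v) = v"
  by (simp add: flow_form_def)

lemma flow_form_eq_0_iff: "flow_form \<alpha> z = 0 \<longleftrightarrow> (\<exists>t. z = t *\<^sub>R (1, \<alpha>))"
  by (cases z) (auto simp: flow_form_def)

text \<open>The elements of the holonomy group are the periods of the form: \<open>(-1, 0)\<close>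
  has the period \<open>\<alpha>\<close> and \<open>(0, axis i 1)\<close> the period
  \<open>axis i 1\<close>.\<close>

lemma holonomy_group_eq: "holonomy_group \<alpha> = flow_form \<alpha> ` integer_lattice"
proof
  let ?S = "insert \<alpha> (range (\<lambda>i. axis i 1))"
  note lin = flow_form_linear[of \<alpha>]
  show "holonomy_group \<alpha> \<subseteq> flow_form \<alpha> ` integer_lattice"
  proof
    fix v assume "v \<in> holonomy_group \<alpha>"
    then have "v \<in> group_closure ?S" by (simp add: holonomy_group_def)
    then show "v \<in> flow_form \<alpha> ` integer_lattice"
    proof (induction rule: group_closure.induct)
      case (base s)
      then consider "s = 0" | "s = \<alpha>" | i where "s = axis i 1" by auto
      then show ?case
      proof cases
        case 1
        then show ?thesis using integer_lattice_zero linear_0[OF lin] by (metis image_eqI)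
      next
        case 2
        then show ?thesis by (intro image_eqI[of _ _ "(-1, 0)"]) (auto simp: flow_form_def integer_lattice_def)
      next
        case 3
        then show ?thesis by (intro image_eqI[of _ _ "(0, axis i 1)"]) (auto simp: integer_lattice_def axis_def)
      qed
    next
      case (diff s t)
      then obtain l l' where "l \<in> integer_lattice" "l' \<in> integer_lattice" "s = flow_form \<alpha> l" "t = flow_form \<alpha> l'"
        by blast
      then show ?case by (intro image_eqI[of _ _ "l - l'"]) (simp_all add: linear_diff[OF lin] integer_lattice_diff)
    qed
  qed
  have nat: "of_nat n *\<^sub>R s \<in> group_closure ?S" if "s \<in> group_closure ?S" for n s
    by (induction n) (use that in \<open>auto simp: algebra_simps intro: group_closure_add\<close>)
  have int: "x *\<^sub>R s \<in> group_closure ?S" if s0: "s \<in> ?S" and x: "x \<in> \<int>" for x s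
  proof -
    have s: "s \<in> group_closure ?S" using s0 by (intro group_closure.base) simp
    obtain k :: int where k: "x = of_int k" using x by (rule Ints_cases)
    have "of_int k *\<^sub>R s = (if 0 \<le> k then of_nat (nat k) *\<^sub>R s else - (of_nat (nat (- k)) *\<^sub>R s))"
      by (simp flip: scaleR_minus_left)
    then show ?thesis using nat[OF s] unfolding k by (simp del: of_nat_nat of_nat_0_le_iff)
  qed
  show "flow_form \<alpha> ` integer_lattice \<subseteq> holonomy_group \<alpha>"
  proof clarify
    fix a b assume ab: "(a, b) \<in> (integer_lattice :: (real \<times> (real^'a)) set)"
    have "(\<Sum>i\<in>I. b $ i *\<^sub>R axis i 1) \<in> group_closure ?S" for I
      using ab by (induction I rule: infinite_finite_induct)
        (auto simp: integer_lattice_def intro!: group_closure_add int)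
    moreover have "b = (\<Sum>i\<in>UNIV. b $ i *\<^sub>R axis i 1)"
      using basis_expansion[of b] by (simp add: scalar_mult_eq_scaleR)
    ultimately have "b \<in> group_closure ?S" by metis
    moreover have "a *\<^sub>R \<alpha> \<in> group_closure ?S" using ab by (intro int) (auto simp: integer_lattice_def)
    ultimately show "flow_form \<alpha> (a, b) \<in> holonomy_group \<alpha>"
      unfolding holonomy_group_def flow_form_def by (simp add: group_closure.diff)
  qed
qed

text \<open>Along a tangent path \<open>flow_form \<alpha> (c t)\<close> has derivative 0, so the
  displacement lies in the kernel of the form, the line of \<open>(1, \<alpha>)\<close>. Conversely
  straight segments are tangent paths.\<close>

lemma leaf_torus_proj: "leaf \<alpha> (torus_proj z) = range (\<lambda>t. torus_proj (z + t *\<^sub>R (1, \<alpha>)))"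
proof (intro equalityI subsetI)
  fix Q assume "Q \<in> leaf \<alpha> (torus_proj z)"
  then obtain c c' where c: "\<And>t. t \<in> {0..1} \<Longrightarrow> (c has_vector_derivative c' t) (at t within {0..1})"
    "\<And>t. t \<in> {0..1} \<Longrightarrow> flow_form \<alpha> (c' t) = 0" "torus_proj (c 0) = torus_proj z" "torus_proj (c 1) = Q"
    unfolding leaf_def by blast
  have bl: "bounded_linear (flow_form \<alpha>)"
    using flow_form_linear by (simp add: linear_conv_bounded_linear)
  have "flow_form \<alpha> (c 1) = flow_form \<alpha> (c 0)"
  proof (rule has_derivative_zero_unique[of "{0..1::real}"])
    fix t :: real assume t: "t \<in> {0..1}"
    have "((\<lambda>t. flow_form \<alpha> (c t)) has_vector_derivative 0) (at t within {0..1})"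
      using bounded_linear.has_vector_derivative[OF bl c(1)[OF t]] c(2)[OF t] by simp
    then show "((\<lambda>t. flow_form \<alpha> (c t)) has_derivative (\<lambda>h. 0)) (at t within {0..1})"
      by (simp add: has_vector_derivative_def)
  qed auto
  then have "flow_form \<alpha> (c 1 - c 0) = 0" by (simp add: linear_diff[OF flow_form_linear])
  then obtain t where t: "c 1 - c 0 = t *\<^sub>R (1, \<alpha>)" unfolding flow_form_eq_0_iff by blast
  \<comment> \<open>The lifted path may start at another lift of the same point; the lattice vector
    \<open>c 0 - z\<close> is carried along to its end.\<close>
  have "c 1 - (z + t *\<^sub>R (1, \<alpha>)) = c 0 - z" unfolding t[symmetric] by simp
  then have "Q = torus_proj (z + t *\<^sub>R (1, \<alpha>))"
    using c(3,4) torus_proj_eq_iff by metis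
  then show "Q \<in> range (\<lambda>t. torus_proj (z + t *\<^sub>R (1, \<alpha>)))" by (rule range_eqI)
next
  fix Q assume "Q \<in> range (\<lambda>t. torus_proj (z + t *\<^sub>R (1, \<alpha>)))"
  then obtain t where t: "Q = torus_proj (z + t *\<^sub>R (1, \<alpha>))" by blast
  let ?c = "\<lambda>s. z + (s * t) *\<^sub>R (1, \<alpha>)" and ?c' = "\<lambda>s::real. t *\<^sub>R (1, \<alpha>)"
  have "(?c has_vector_derivative ?c' s) (at s within {0..1})" for s
    unfolding has_vector_derivative_def by (auto intro!: derivative_eq_intros)
  moreover have "flow_form \<alpha> (?c' s) = 0" for s unfolding flow_form_eq_0_iff by blast
  moreover have "continuous_on {0..1} ?c'" by simp
  moreover have "torus_proj (?c 0) = torus_proj z" "torus_proj (?c 1) = Q" using t by (simp_all del: scaleR_Pair)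
  ultimately show "Q \<in> leaf \<alpha> (torus_proj z)"
    unfolding leaf_def by (intro CollectI exI[of _ ?c] exI[of _ ?c'] conjI ballI)
qed

text \<open>In this form the leaf visibly depends only on the class of
  \<open>flow_form \<alpha> z\<close> modulo the holonomy group.\<close>

lemma leaf_eq_image: "leaf \<alpha> (torus_proj z) = torus_proj ` {w. flow_form \<alpha> w - flow_form \<alpha> z \<in> holonomy_group \<alpha>}"
proof (intro equalityI subsetI)
  note lin = flow_form_linear[of \<alpha>]
  fix Q assume "Q \<in> leaf \<alpha> (torus_proj z)"
  then obtain t where t: "Q = torus_proj (z + t *\<^sub>R (1, \<alpha>))" unfolding leaf_torus_proj by blast
  have "flow_form \<alpha> (t *\<^sub>R (1, \<alpha>)) = 0" unfolding flow_form_eq_0_iff by blast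
  then have "flow_form \<alpha> (z + t *\<^sub>R (1, \<alpha>)) - flow_form \<alpha> z = flow_form \<alpha> 0"
    by (simp add: linear_add[OF lin] linear_0[OF lin])
  then show "Q \<in> torus_proj ` {w. flow_form \<alpha> w - flow_form \<alpha> z \<in> holonomy_group \<alpha>}"
    unfolding t holonomy_group_eq using integer_lattice_zero by blast
next
  note lin = flow_form_linear[of \<alpha>]
  fix Q assume "Q \<in> torus_proj ` {w. flow_form \<alpha> w - flow_form \<alpha> z \<in> holonomy_group \<alpha>}"
  then obtain w l where w: "Q = torus_proj w" "flow_form \<alpha> w - flow_form \<alpha> z = flow_form \<alpha> l" "l \<in> integer_lattice"
    unfolding holonomy_group_eq by blast
  then have "flow_form \<alpha> (w - z - l) = 0" by (simp add: linear_diff[OF lin])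
  then obtain t where "w - z - l = t *\<^sub>R (1, \<alpha>)" unfolding flow_form_eq_0_iff by blast
  then have "w - (z + t *\<^sub>R (1, \<alpha>)) = l" by (simp add: algebra_simps)
  then have "Q = torus_proj (z + t *\<^sub>R (1, \<alpha>))" using w torus_proj_eq_iff by metis
  then show "Q \<in> leaf \<alpha> (torus_proj z)" unfolding leaf_torus_proj by blast
qed

lemma Union_leaf: "\<Union>(leaf \<alpha> (torus_proj z)) = {w. flow_form \<alpha> w - flow_form \<alpha> z \<in> holonomy_group \<alpha>}"
proof (intro equalityI subsetI)
  note lin = flow_form_linear[of \<alpha>]
  fix x assume "x \<in> \<Union>(leaf \<alpha> (torus_proj z))"
  then obtain t where "x - (z + t *\<^sub>R (1, \<alpha>)) \<in> integer_lattice" (is "?l \<in> _")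
    unfolding leaf_torus_proj by (auto simp: mem_torus_proj)
  moreover have "flow_form \<alpha> (t *\<^sub>R (1, \<alpha>)) = 0" unfolding flow_form_eq_0_iff by blast
  then have "flow_form \<alpha> ?l = flow_form \<alpha> x - flow_form \<alpha> z"
    by (simp only: linear_diff[OF lin] linear_add[OF lin]) simp
  ultimately show "x \<in> {w. flow_form \<alpha> w - flow_form \<alpha> z \<in> holonomy_group \<alpha>}"
    unfolding holonomy_group_eq by (metis imageI mem_Collect_eq)
next
  fix x assume "x \<in> {w. flow_form \<alpha> w - flow_form \<alpha> z \<in> holonomy_group \<alpha>}"
  then have "torus_proj x \<in> leaf \<alpha> (torus_proj z)" unfolding leaf_eq_image by blast
  moreover have "x \<in> torus_proj x" by (simp add: mem_torus_proj integer_lattice_zero)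
  ultimately show "x \<in> \<Union>(leaf \<alpha> (torus_proj z))" by blast
qed

section \<open>Leaves and cosets of the holonomy group\<close>

lemma holonomy_group_zero: "0 \<in> holonomy_group \<alpha>"
  by (simp add: holonomy_group_def)

lemma holonomy_group_diff: "x \<in> holonomy_group \<alpha> \<Longrightarrow> y \<in> holonomy_group \<alpha> \<Longrightarrow> x - y \<in> holonomy_group \<alpha>"
  by (simp add: holonomy_group_def group_closure.diff)

lemma mem_coset: "w \<in> holonomy_group \<alpha> #>\<^bsub>additive_group\<^esub> v \<longleftrightarrow> w - v \<in> holonomy_group \<alpha>"
  by (force simp: r_coset_def additive_group_def intro!: bexI[of _ "w - v"])

lemma coset_eq_iff:
  "holonomy_group \<alpha> #>\<^bsub>additive_group\<^esub> v = holonomy_group \<alpha> #>\<^bsub>additive_group\<^esub> v' \<longleftrightarrow> v - v' \<in> holonomy_group \<alpha>"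
    (is "?L = ?R \<longleftrightarrow> _")
proof
  assume "?L = ?R"
  then show "v - v' \<in> holonomy_group \<alpha>" using holonomy_group_zero[of \<alpha>]
    by (metis diff_self mem_coset)
next
  assume d: "v - v' \<in> holonomy_group \<alpha>"
  have "w - v \<in> holonomy_group \<alpha> \<longleftrightarrow> w - v' \<in> holonomy_group \<alpha>" for w
    using holonomy_group_diff[of "w - v'" \<alpha> "v - v'"] holonomy_group_diff[of "w - v" \<alpha> "v' - v"]
      holonomy_group_diff[OF holonomy_group_zero d] d by auto
  then show "?L = ?R" by (auto simp: mem_coset)
qed

text \<open>Leaves are parametrised by the transversal where \<open>x = 0\<close>; each leaf meets
  it, since a point can be moved along its flow line to \<open>x = 0\<close>.\<close>

definition leaf_of :: "real^'n \<Rightarrow> real^'n \<Rightarrow> (real \<times> (real^'n)) set set"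
  where "leaf_of \<alpha> v = leaf \<alpha> (torus_proj (0, v))"

lemma leaf_eq_leaf_of: "leaf \<alpha> (torus_proj z) = leaf_of \<alpha> (flow_form \<alpha> z)"
  unfolding leaf_of_def leaf_eq_image by simp

lemma leaf_of_eq_iff: "leaf_of \<alpha> v = leaf_of \<alpha> v' \<longleftrightarrow> v - v' \<in> holonomy_group \<alpha>"
proof
  assume "leaf_of \<alpha> v = leaf_of \<alpha> v'"
  then have "(0, v) \<in> \<Union>(leaf_of \<alpha> v')"
    using holonomy_group_zero[of \<alpha>] by (metis (mono_tags) leaf_of_def Union_leaf mem_Collect_eq diff_self)
  then show "v - v' \<in> holonomy_group \<alpha>" unfolding leaf_of_def Union_leaf by simp
next
  assume "v - v' \<in> holonomy_group \<alpha>"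
  then have "w - v \<in> holonomy_group \<alpha> \<longleftrightarrow> w - v' \<in> holonomy_group \<alpha>" for w
    using coset_eq_iff mem_coset by metis
  then show "leaf_of \<alpha> v = leaf_of \<alpha> v'" unfolding leaf_of_def leaf_eq_image by simp
qed

lemma leaf_to_coset_leaf_of: "leaf_to_coset \<alpha> (leaf_of \<alpha> v) = holonomy_group \<alpha> #>\<^bsub>additive_group\<^esub> v"
proof -
  have "(\<lambda>(x, y). y - x *\<^sub>R \<alpha>) = flow_form \<alpha>" by (simp add: flow_form_def)
  moreover have "flow_form \<alpha> ` {w. flow_form \<alpha> w - v \<in> holonomy_group \<alpha>} = {u. u - v \<in> holonomy_group \<alpha>}"
    by (auto intro!: image_eqI[of u "flow_form \<alpha>" "(0, u)" for u])
  ultimately show ?thesis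
    unfolding leaf_to_coset_def leaf_of_def Union_leaf by (auto simp: mem_coset)
qed

lemma plot_quotient_diffeology:
  "plot (quotient_diffeology X \<pi>) p U f \<longleftrightarrow> openin (Euclidean_space p) U \<and>
     (\<forall>u\<in>U. \<exists>V g. u \<in> V \<and> V \<subseteq> U \<and> plot X p V g \<and> (\<forall>v\<in>V. f v = \<pi> (g v)))"
  by (simp add: quotient_diffeology_def)

text \<open>A plot of the leaf space lifts first to the torus and then to the universal cover, and
  \<open>flow_form \<alpha>\<close> carries that lift to \<open>real^'n\<close>. In the other
  direction \<open>v\<close> is sent to \<open>(0, v)\<close>. Both maps are linear, so smoothness
  is preserved.\<close>

lemma leaf_space_eq: "leaf_space \<alpha> = quotient_diffeology standard_diffeology (leaf_of \<alpha>)"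
proof -
  have pts: "points (leaf_space \<alpha>) = range (leaf_of \<alpha>)"
  proof -
    have "points (leaf_space \<alpha>) = (\<lambda>z. leaf_of \<alpha> (flow_form \<alpha> z)) ` UNIV"
      by (simp add: leaf_space_def torus_def quotient_diffeology_def standard_diffeology_def image_image leaf_eq_leaf_of)
    also have "\<dots> = range (leaf_of \<alpha>)"
      by (auto, metis flow_form_0_right rangeI)
    finally show ?thesis .
  qed
  have bl: "bounded_linear (flow_form \<alpha>)"
    using flow_form_linear by (simp add: linear_conv_bounded_linear)
  have bl2: "bounded_linear (\<lambda>v::real^'a. (0::real, v))"
    by (intro bounded_linear_Pair bounded_linear_zero bounded_linear_ident)
  have "plot (leaf_space \<alpha>) p U f \<longleftrightarrow> plot (quotient_diffeology standard_diffeology (leaf_of \<alpha>)) p U f" for p U f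
  proof
    assume "plot (leaf_space \<alpha>) p U f"
    then have U: "openin (Euclidean_space p) U" and
      f: "\<And>u. u \<in> U \<Longrightarrow> \<exists>V g. u \<in> V \<and> V \<subseteq> U \<and> plot torus p V g \<and> (\<forall>v\<in>V. f v = leaf \<alpha> (g v))"
      unfolding leaf_space_def plot_quotient_diffeology by blast+
    show "plot (quotient_diffeology standard_diffeology (leaf_of \<alpha>)) p U f"
      unfolding plot_quotient_standard
    proof (intro conjI ballI U)
      fix u assume "u \<in> U"
      from f[OF this] obtain V g where V: "u \<in> V" "V \<subseteq> U" "plot torus p V g" "\<forall>v\<in>V. f v = leaf \<alpha> (g v)" by blast
      from bspec[OF conjunct2[OF V(3)[unfolded torus_def plot_quotient_standard]] V(1)]
      obtain W h where W: "u \<in> W" "W \<subseteq> V" "openin (Euclidean_space p) W" "C_infinity_on p W h" "\<forall>v\<in>W. g v = torus_proj (h v)"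
        by blast
      have "C_infinity_on p W (\<lambda>v. flow_form \<alpha> (h v) + 0)"
        by (rule C_infinity_on_affine[OF bl W(4)])
      moreover have "f v = leaf_of \<alpha> (flow_form \<alpha> (h v) + 0)" if "v \<in> W" for v
        using V W that by (auto simp: leaf_eq_leaf_of)
      ultimately show "\<exists>V g. u \<in> V \<and> V \<subseteq> U \<and> openin (Euclidean_space p) V \<and> C_infinity_on p V g \<and> (\<forall>v\<in>V. f v = leaf_of \<alpha> (g v))"
        using V(2) W(1,2,3) by (intro exI[of _ W] exI[of _ "\<lambda>v. flow_form \<alpha> (h v) + 0"]) auto
    qed
  next
    assume "plot (quotient_diffeology standard_diffeology (leaf_of \<alpha>)) p U f"
    then have U: "openin (Euclidean_space p) U" and
      f: "\<And>u. u \<in> U \<Longrightarrow> \<exists>V g. u \<in> V \<and> V \<subseteq> U \<and> openin (Euclidean_space p) V \<and> C_infinity_on p V g \<and> (\<forall>v\<in>V. f v = leaf_of \<alpha> (g v))"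
      unfolding plot_quotient_standard by blast+
    have "\<exists>V g. u \<in> V \<and> V \<subseteq> U \<and> plot torus p V g \<and> (\<forall>v\<in>V. f v = leaf \<alpha> (g v))" if "u \<in> U" for u
    proof -
      from f[OF that] obtain V g where V: "u \<in> V" "V \<subseteq> U" "openin (Euclidean_space p) V" "C_infinity_on p V g" "\<forall>v\<in>V. f v = leaf_of \<alpha> (g v)"
        by blast
      have "C_infinity_on p V (\<lambda>v. (0::real, g v) + 0)"         using C_infinity_on_affine[OF bl2 V(4), of 0] by simp
      then have "plot torus p V (\<lambda>v. torus_proj ((0, g v) + 0))"
        unfolding torus_def plot_quotient_standard using V(3) by blast
      moreover have "\<forall>v\<in>V. f v = leaf \<alpha> (torus_proj ((0, g v) + 0))" using V(5) by (simp add: leaf_of_def)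
      ultimately show ?thesis using V(1,2) by blast
    qed
    with U show "plot (leaf_space \<alpha>) p U f" unfolding leaf_space_def plot_quotient_diffeology by blast
  qed
  then have "plot (leaf_space \<alpha>) = plot (quotient_diffeology standard_diffeology (leaf_of \<alpha>))"
    by (intro ext) blast
  then show ?thesis by (intro diffeology.equality) (simp_all add: pts points_quotient_standard)
qed

lemma diffeomorphism_leaf_to_coset:
  "diffeomorphism (leaf_space \<alpha>) (holonomy_quotient_space \<alpha>) (leaf_to_coset \<alpha>)"
  unfolding leaf_space_eq holonomy_quotient_space_def
  by (rule diffeomorphism_same_fibres) (simp_all add: leaf_to_coset_leaf_of leaf_of_eq_iff coset_eq_iff)

text \<open>Pulled back by \<open>flow_form \<alpha>\<close> and projected, \<open>W\<close> becomes
  a nonempty open set of the torus. The leaf through the origin meets it, and the form takes values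
  in the holonomy group over this leaf.\<close>

lemma dense_leaves_imp_dense_holonomy:
  assumes "dense_leaves \<alpha>" and W: "open W" "W \<noteq> {}"
  shows "W \<inter> holonomy_group \<alpha> \<noteq> {}"
proof -
  define T where "T = torus_proj ` (flow_form \<alpha> -` W)"
  have opn: "openin torus_topology S \<longleftrightarrow> S \<subseteq> range torus_proj \<and> open {x. torus_proj x \<in> S}" for S :: "(real \<times> (real^'a)) set set"
    by (simp add: torus_topology_def openin_quotient_topology)
  have "open (flow_form \<alpha> -` W)"
    by (intro open_vimage W linear_continuous_on) (simp add: flow_form_linear linear_conv_bounded_linear[symmetric])
  \<comment> \<open>The preimage of \<open>T\<close> upstairs is the union of the lattice translates
    of an open set.\<close>
  then have "open (\<Union>l\<in>integer_lattice. (+) l ` (flow_form \<alpha> -` W))" by (intro open_UN) (auto intro: open_translation)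
  also have "(\<Union>l\<in>integer_lattice. (+) l ` (flow_form \<alpha> -` W)) = {x. torus_proj x \<in> T}"
    by (force simp: T_def torus_proj_eq_iff image_iff)
  finally have T: "openin torus_topology T" unfolding opn by (auto simp: T_def)
  obtain v where "v \<in> W" using W(2) by blast
  then have v: "torus_proj (0, v) \<in> T" by (auto simp: T_def)
  have "leaf_of \<alpha> 0 \<in> points (leaf_space \<alpha>)" by (simp add: leaf_space_eq points_quotient_standard)
  then have "torus_topology closure_of (leaf_of \<alpha> 0) = topspace torus_topology"
    using assms(1) by (simp add: dense_leaves_def)
  then have "torus_proj (0, v) \<in> torus_topology closure_of (leaf_of \<alpha> 0)"
    using v openin_subset[OF T] by blast
  then obtain P where P: "P \<in> leaf_of \<alpha> 0" "P \<in> T" using v T unfolding in_closure_of by blast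
  then obtain z where z: "P = torus_proj z" "flow_form \<alpha> z \<in> W" by (auto simp: T_def)
  have "z \<in> \<Union>(leaf_of \<alpha> 0)" using P(1) z(1) by (auto simp: mem_torus_proj integer_lattice_zero)
  then have "flow_form \<alpha> z \<in> holonomy_group \<alpha>" unfolding leaf_of_def Union_leaf by simp
  then show ?thesis using z(2) by blast
qed

lemma countable_holonomy_group: "countable (holonomy_group \<alpha>)"
proof -
  have "integer_lattice \<subseteq> (\<lambda>(a, f :: 'a \<Rightarrow> int). (of_int a, \<chi> i. of_int (f i))) ` UNIV"
  proof clarify
    fix a :: real and b :: "real^'a" assume ab: "(a, b) \<in> integer_lattice"
    then obtain k f where "a = of_int k" "\<And>i. b $ i = of_int (f i)"
      unfolding integer_lattice_def Ints_def by (auto simp: image_iff) metis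
    then show "(a, b) \<in> range (\<lambda>(a, f :: 'a \<Rightarrow> int). (of_int a, \<chi> i. of_int (f i)))"
      by (intro image_eqI[of _ _ "(k, f)"]) (auto simp: vec_eq_iff)
  qed
  then have "countable (integer_lattice :: (real \<times> (real^'a)) set)" by (rule countable_subset) simp
  then show ?thesis by (simp add: holonomy_group_eq)
qed


section \<open>Automorphisms of the holonomy group\<close>

text \<open>
  The index \<open>None\<close> stands for the generator \<open>\<alpha>\<close> of \<open>\<Gamma>\<close> and \<open>Some i\<close> for \<open>e\<^sub>i\<close>; \<open>flow_vec \<alpha>\<close> spans the
  kernel of \<open>period_map \<alpha>\<close>, which maps \<open>\<int>\<^sup>n\<^sup>+\<^sup>1\<close> onto \<open>\<Gamma>\<close>.
\<close>

definition flow_vec :: "real^'n \<Rightarrow> real^('n option)"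
  where "flow_vec \<alpha> = (\<chi> p. case p of None \<Rightarrow> -1 | Some i \<Rightarrow> \<alpha> $ i)"

definition period_map :: "real^'n \<Rightarrow> real^('n option) \<Rightarrow> real^'n"
  where "period_map \<alpha> x = (\<chi> i. x $ Some i + x $ None * \<alpha> $ i)"

definition period_section :: "real^'n \<Rightarrow> real^('n option)"
  where "period_section v = (\<chi> p. case p of None \<Rightarrow> 0 | Some i \<Rightarrow> v $ i)"

definition of_int_vec :: "int^'m \<Rightarrow> real^'m"
  where "of_int_vec k = (\<chi> p. of_int (k $ p))"

lemma sum_UNIV_option: "(\<Sum>p\<in>UNIV. f p) = f None + (\<Sum>i\<in>UNIV. f (Some i))"
  for f :: "'n::finite option \<Rightarrow> 'b::comm_monoid_add"
  by (simp add: UNIV_option_conv sum.reindex)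

lemma period_map_linear: "linear (period_map \<alpha>)"
  by (rule linearI) (auto simp: period_map_def vec_eq_iff algebra_simps)

lemma period_map_section [simp]: "period_map \<alpha> (period_section v) = v"
  by (simp add: period_map_def period_section_def vec_eq_iff)

lemma period_section_linear: "linear period_section"
  by (rule linearI) (auto simp: period_section_def vec_eq_iff split: option.split)

lemma period_map_eq_0_iff: "period_map \<alpha> x = 0 \<longleftrightarrow> (\<exists>t. x = t *s flow_vec \<alpha>)"
proof
  assume z: "period_map \<alpha> x = 0"
  have "x $ p = (- x $ None) * flow_vec \<alpha> $ p" for p
  proof (cases p)
    case (Some i)
    have "x $ Some i + x $ None * \<alpha> $ i = 0" using z by (simp add: period_map_def vec_eq_iff)
    then show ?thesis by (simp add: Some flow_vec_def)
  qed (simp add: flow_vec_def)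
  then have "x = (- x $ None) *s flow_vec \<alpha>" unfolding vec_eq_iff vector_smult_component by blast
  then show "\<exists>t. x = t *s flow_vec \<alpha>" by blast
qed (auto simp: period_map_def flow_vec_def vec_eq_iff)

lemma holonomy_group_eq_period_map: "holonomy_group \<alpha> = range (\<lambda>k. period_map \<alpha> (of_int_vec k))"
proof (intro equalityI subsetI)
  fix v assume "v \<in> holonomy_group \<alpha>"
  then obtain a b where v: "v = b - a *\<^sub>R \<alpha>" "(a, b) \<in> integer_lattice"
    by (auto simp: holonomy_group_eq flow_form_def)
  then obtain m k where m: "a = of_int m" "\<And>i. b $ i = of_int (k i)"
    unfolding integer_lattice_def Ints_def by (auto simp: image_iff) metis
  \<comment> \<open>The minus sign arises because \<open>flow_form\<close> subtracts multiples of
    \<open>\<alpha>\<close> while \<open>period_map\<close> adds them.\<close>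
  have "v = period_map \<alpha> (of_int_vec (\<chi> p. case p of None \<Rightarrow> - m | Some i \<Rightarrow> k i))"
    by (simp add: v m period_map_def of_int_vec_def vec_eq_iff)
  then show "v \<in> range (\<lambda>k. period_map \<alpha> (of_int_vec k))" by blast
next
  fix v assume "v \<in> range (\<lambda>k. period_map \<alpha> (of_int_vec k))"
  then obtain k where k: "v = period_map \<alpha> (of_int_vec k)" by blast
  have "v = flow_form \<alpha> (- of_int (k $ None), \<chi> i. of_int (k $ Some i))"
    by (simp add: k period_map_def of_int_vec_def flow_form_def vec_eq_iff)
  moreover have "(- of_int (k $ None), \<chi> i. of_int (k $ Some i)) \<in> integer_lattice"
    by (simp add: integer_lattice_def)
  ultimately show "v \<in> holonomy_group \<alpha>" unfolding holonomy_group_eq by blast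
qed

lemma of_int_mat_mult_of_int_vec: "of_int_mat T *v of_int_vec k = of_int_vec (T *v k)"
  by (simp add: of_int_mat_def of_int_vec_def matrix_vector_mult_def vec_eq_iff)

lemma of_int_vec_diff: "of_int_vec (k - l) = of_int_vec k - of_int_vec l"
  by (simp add: of_int_vec_def vec_eq_iff)

lemma of_int_mat_axis: "of_int_mat T *v axis p 1 = of_int_vec (\<chi> q. T $ q $ p)"
  by (simp add: matrix_vector_mult_basis column_def of_int_mat_def of_int_vec_def)

section \<open>Arithmetic consequences of density\<close>

locale dense_flow =
  fixes \<alpha> :: "real^'n::finite"
  assumes dense_leaves: "dense_leaves \<alpha>"
begin

abbreviation \<Gamma> where "\<Gamma> \<equiv> holonomy_group \<alpha>"

abbreviation G where "G \<equiv> period_map \<alpha>"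

text \<open>A relation yields a linear functional \<open>f\<close> with integer coefficients that is
  also integral at \<open>\<alpha>\<close>, hence on all of \<open>\<Gamma>\<close>. If
  \<open>f\<close> is not 0, the open set where it lies strictly between 0 and 1 is nonempty and
  misses \<open>\<Gamma>\<close>.\<close>

lemma flow_vec_independent:
  assumes "(\<Sum>p\<in>UNIV. of_int (k $ p) * flow_vec \<alpha> $ p) = 0"
  shows "k = 0"
proof -
  have s: "(\<Sum>i\<in>UNIV. of_int (k $ Some i) * \<alpha> $ i) = of_int (k $ None)"
    using assms by (simp add: sum_UNIV_option flow_vec_def)
  define f where "f v = (\<Sum>i\<in>UNIV. of_int (k $ Some i) * v $ i)" for v :: "real^'n"
  have fG: "f v \<in> \<int>" if "v \<in> \<Gamma>" for v
  proof -
    obtain a b where v: "v = b - a *\<^sub>R \<alpha>" "(a, b) \<in> integer_lattice"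
      using \<open>v \<in> \<Gamma>\<close> by (auto simp: holonomy_group_eq flow_form_def)
    have "f v = f b - a * f \<alpha>"
      by (simp add: v f_def sum_subtractf sum_distrib_left algebra_simps)
    moreover have "f b \<in> \<int>" using v(2) by (auto simp: f_def integer_lattice_def)
    ultimately show ?thesis using v(2) s by (auto simp: f_def integer_lattice_def)
  qed
  have zero: "k $ Some i = 0" for i
  proof (rule ccontr)
    assume ki: "k $ Some i \<noteq> 0"
    let ?W = "f -` {0<..<1}"
    have "continuous_on UNIV f" unfolding f_def by (intro continuous_intros)
    then have "open ?W" by (intro open_vimage) auto
    \<comment> \<open>A point where \<open>f\<close> takes the value 1/2.\<close>
    moreover have "f (axis i (1 / (2 * of_int (k $ Some i)))) = 1 / 2"
      using ki by (simp add: f_def axis_def if_distrib cong: if_cong)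
    then have "axis i (1 / (2 * of_int (k $ Some i))) \<in> ?W" by simp
    then have "?W \<noteq> {}" by blast
    ultimately obtain v where v: "v \<in> \<Gamma>" "0 < f v" "f v < 1"
      using dense_leaves_imp_dense_holonomy[OF dense_leaves, of ?W] by auto
    obtain m where "f v = of_int m" using fG[OF v(1)] by (rule Ints_cases)
    then show False using v by simp
  qed
  have "k $ p = 0" for p using zero s by (cases p) auto
  then show ?thesis by (simp add: vec_eq_iff)
qed

sublocale integrally_independent "flow_vec \<alpha>"
  by unfold_locales (rule flow_vec_independent)

sublocale dense_quotient \<Gamma> "leaf_of \<alpha>"
  by unfold_locales
    (simp_all add: holonomy_group_zero holonomy_group_diff countable_holonomy_group leaf_of_eq_iff
      dense_leaves_imp_dense_holonomy[OF dense_leaves])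

text \<open>Every coordinate of the equation is an integer relation between 1 and one entry of
  \<open>\<alpha>\<close>. Hence \<open>\<Gamma>\<close> is free on its \<open>n + 1\<close>
  generators.\<close>

lemma period_map_of_int_inj:
  assumes "G (of_int_vec k) = 0"
  shows "k = 0"
proof -
  have e: "of_int (k $ Some i) + of_int (k $ None) * \<alpha> $ i = 0" for i
    using assms by (simp add: period_map_def of_int_vec_def vec_eq_iff)
  have "k $ None = 0 \<and> k $ Some i = 0" for i
  proof -
    \<comment> \<open>The entry of \<open>flow_vec \<alpha>\<close> at \<open>None\<close> is -1,
      which accounts for the sign.\<close>
    let ?l = "\<chi> p. case p of None \<Rightarrow> - (k $ Some i) | Some j \<Rightarrow> if j = i then k $ None else 0"
    have "(\<Sum>p\<in>UNIV. of_int (?l $ p) * flow_vec \<alpha> $ p) = 0"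
      using e[of i] by (simp add: sum_UNIV_option flow_vec_def if_distrib if_distribR cong: if_cong)
    then have "?l = 0" by (rule flow_vec_independent)
    then have "?l $ None = 0" "?l $ Some i = 0" by (simp_all only: zero_index)
    then show ?thesis by simp
  qed
  then have "k $ p = 0" for p by (cases p) auto
  then show ?thesis by (simp add: vec_eq_iff)
qed

section \<open>Automorphisms of the holonomy group as units\<close>

lemma period_mat_unique:
  assumes "\<And>x. G (of_int_mat S *v x) = G (of_int_mat T *v x)"
  shows "S = T"
proof -
  have "(\<chi> q. S $ q $ p) - (\<chi> q. T $ q $ p) = 0" for p
    using assms[of "axis p 1"]
    by (intro period_map_of_int_inj) (simp add: of_int_mat_axis of_int_vec_diff linear_diff[OF period_map_linear])
  then show ?thesis by (simp add: vec_eq_iff)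
qed

text \<open>The images of the generators of \<open>\<Gamma>\<close> are written as integer
  combinations of the generators; the coefficients are the columns of \<open>T\<close>.\<close>

lemma period_mat_exists:
  assumes lin: "linear \<phi>" and pres: "\<phi> ` \<Gamma> \<subseteq> \<Gamma>"
  obtains T where "\<And>x. G (of_int_mat T *v x) = \<phi> (G x)"
proof -
  have "\<exists>k. G (of_int_vec k) = \<phi> (G (axis p 1))" for p
  proof -
    have "axis p 1 = of_int_vec (axis p 1)" by (simp add: of_int_vec_def axis_def vec_eq_iff)
    then have "G (axis p 1) \<in> \<Gamma>" unfolding holonomy_group_eq_period_map by (metis rangeI)
    then have "\<phi> (G (axis p 1)) \<in> \<Gamma>" using pres by blast
    then show ?thesis unfolding holonomy_group_eq_period_map by auto
  qed
  then obtain k where k: "\<And>p. G (of_int_vec (k p)) = \<phi> (G (axis p 1))" by metis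
  define T where "T = (\<chi> q p. k p $ q)"
  have "(\<lambda>x. G (of_int_mat T *v x)) = (\<lambda>x. \<phi> (G x))"
  proof (rule linear_eq_stdbasis)
    show "linear (\<lambda>x. G (of_int_mat T *v x))"
      using linear_compose[OF matrix_vector_mul_linear period_map_linear] by (simp add: o_def)
    show "linear (\<lambda>x. \<phi> (G x))"
      using linear_compose[OF period_map_linear lin] by (simp add: o_def)
    fix b :: "real^('n option)" assume "b \<in> Basis"
    then obtain p where "b = axis p 1" by (auto simp: Basis_vec_def)
    then show "G (of_int_mat T *v b) = \<phi> (G b)" by (simp add: of_int_mat_axis T_def k)
  qed
  then show ?thesis using that by metis
qed

text \<open>The matrix of a unit preserves the line of \<open>flow_vec \<alpha>\<close>, which is
  the kernel of \<open>G\<close>, and so induces a map of \<open>real^'n\<close>. The section merely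
  picks a preimage under \<open>G\<close>.\<close>

definition unit_aut :: "real \<Rightarrow> real^'n \<Rightarrow> real^'n"
  where "unit_aut x v = G (of_int_mat (mult_mat x) *v period_section v)"

lemma unit_aut_period_map:
  assumes "x \<in> multiplier_units"
  shows "unit_aut x (G y) = G (of_int_mat (mult_mat x) *v y)"
proof -
  have "G (y - period_section (G y)) = 0" by (simp add: linear_diff[OF period_map_linear])
  then obtain t where "y - period_section (G y) = t *s flow_vec \<alpha>" unfolding period_map_eq_0_iff by blast
  then have "of_int_mat (mult_mat x) *v (y - period_section (G y)) = (t * x) *s flow_vec \<alpha>"
    by (simp add: vec.scale mult_mat[OF assms])
  then have "G (of_int_mat (mult_mat x) *v (y - period_section (G y))) = 0"
    unfolding period_map_eq_0_iff by blast
  then show ?thesis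
    by (simp add: unit_aut_def matrix_vector_mult_diff_distrib linear_diff[OF period_map_linear])
qed

lemma unit_aut_linear: "linear (unit_aut x)"
  using linear_compose[OF linear_compose[OF period_section_linear matrix_vector_mul_linear] period_map_linear]
  by (simp add: o_def unit_aut_def[abs_def])

lemma unit_aut_mult:
  assumes "x \<in> multiplier_units" "y \<in> multiplier_units"
  shows "unit_aut (x * y) v = unit_aut x (unit_aut y v)"
  using unit_aut_period_map[OF units_mult[OF assms], of "period_section v"]
    unit_aut_period_map[OF assms(1)] 
  by (simp add: mult_mat_mult[OF assms] of_int_mat_mult matrix_vector_mul_assoc unit_aut_def[of y])

lemma unit_aut_1: "unit_aut 1 v = v"
  by (simp add: unit_aut_def mult_mat_1 of_int_mat_1)

lemma unit_aut_inverse: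
  assumes "x \<in> multiplier_units"
  shows "unit_aut (inverse x) (unit_aut x v) = v" "unit_aut x (unit_aut (inverse x) v) = v"
  using unit_aut_mult[OF units_inverse[OF assms] assms, of v]
    unit_aut_mult[OF assms units_inverse[OF assms], of v] units_nonzero[OF assms]
  by (simp_all add: unit_aut_1)

lemma unit_aut_preserves:
  assumes x: "x \<in> multiplier_units"
  shows "unit_aut x ` \<Gamma> = \<Gamma>"
proof -
  have sub: "unit_aut x v \<in> \<Gamma>" if "x \<in> multiplier_units" "v \<in> \<Gamma>" for x v
    using that(2) unit_aut_period_map[OF that(1)]
    by (auto simp: holonomy_group_eq_period_map of_int_mat_mult_of_int_vec)
  have "v \<in> unit_aut x ` \<Gamma>" if "v \<in> \<Gamma>" for v
    using unit_aut_inverse(2)[OF x, of v] sub[OF units_inverse[OF x] that]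
    by (intro image_eqI[of v "unit_aut x" "unit_aut (inverse x) v"]) simp_all
  then show ?thesis using sub[OF x] by blast
qed

lemma unit_aut_bij: "x \<in> multiplier_units \<Longrightarrow> bij (unit_aut x)"
  by (rule o_bij[of "unit_aut (inverse x)"]) (simp_all add: fun_eq_iff unit_aut_inverse)

lemma unit_aut_inj:
  assumes "x \<in> multiplier_units" "y \<in> multiplier_units" "unit_aut x = unit_aut y"
  shows "x = y"
proof -
  have "mult_mat x = mult_mat y"
    by (rule period_mat_unique) (metis assms unit_aut_period_map)
  then have "x *s flow_vec \<alpha> = y *s flow_vec \<alpha>" using mult_mat assms(1,2) by metis
  then show ?thesis using nonzero by (metis vec.scale_right_imp_eq)
qed

text \<open>Lift the automorphism and its inverse to integer matrices \<open>T\<close> and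
  \<open>S\<close>. Both preserve the kernel of \<open>G\<close>, so
  \<open>flow_vec \<alpha>\<close> is an eigenvector of each; \<open>S ** T = mat 1\<close> makes
  the eigenvalues inverse to each other.\<close>

lemma unit_aut_surj:
  assumes \<phi>: "linear \<phi>" "bij \<phi>" "\<phi> ` \<Gamma> = \<Gamma>"
  obtains x where "x \<in> multiplier_units" "\<phi> = unit_aut x"
proof -
  obtain \<psi> where \<psi>: "linear \<psi>" "\<psi> \<circ> \<phi> = id"
    using linear_injective_left_inverse[OF \<phi>(1)] bij_is_inj[OF \<phi>(2)] by blast
  have \<psi>\<phi>: "\<psi> (\<phi> v) = v" for v using \<psi>(2) by (metis comp_apply id_apply)
  have "\<psi> ` \<Gamma> = \<psi> ` (\<phi> ` \<Gamma>)" using \<phi>(3) by simp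
  also have "\<dots> = \<Gamma>" by (simp add: image_image \<psi>\<phi>)
  finally have \<psi>\<Gamma>: "\<psi> ` \<Gamma> \<subseteq> \<Gamma>" by simp
  obtain T where T: "\<And>x. G (of_int_mat T *v x) = \<phi> (G x)" using period_mat_exists \<phi> by (metis order_refl)
  obtain S where S: "\<And>x. G (of_int_mat S *v x) = \<psi> (G x)" using period_mat_exists[OF \<psi>(1) \<psi>\<Gamma>] by blast
  have w: "G (flow_vec \<alpha>) = 0" unfolding period_map_eq_0_iff by (rule exI[of _ 1]) simp
  obtain x where x: "of_int_mat T *v flow_vec \<alpha> = x *s flow_vec \<alpha>"
    using T[of "flow_vec \<alpha>"] by (auto simp: w linear_0[OF \<phi>(1)] period_map_eq_0_iff)
  obtain y where y: "of_int_mat S *v flow_vec \<alpha> = y *s flow_vec \<alpha>"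
    using S[of "flow_vec \<alpha>"] by (auto simp: w linear_0[OF \<psi>(1)] period_map_eq_0_iff)
  have "S ** T = mat 1"
    by (rule period_mat_unique)
      (simp add: of_int_mat_mult of_int_mat_1 S T \<psi>\<phi> matrix_vector_mul_assoc[symmetric])
  then have "(y * x) *s flow_vec \<alpha> = 1 *s flow_vec \<alpha>" using units_mult_aux[OF y x] by (simp add: of_int_mat_1)
  then have yx: "y * x = 1" using nonzero by (metis vec.scale_right_imp_eq)
  then have "y = inverse x" by (metis inverse_unique mult.commute)
  then have xU: "x \<in> multiplier_units" using x y yx unfolding multiplier_units_def by auto
  moreover have "\<phi> v = unit_aut x v" for v
    using T[of "period_section v"] by (simp add: unit_aut_def mult_mat_eqI[OF x])
  ultimately show ?thesis using that by blast
qed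

lemma unit_aut_iso: "unit_aut \<in> iso unit_group (Aut_holonomy \<alpha>)"
proof (rule isoI)
  show "unit_aut \<in> hom unit_group (Aut_holonomy \<alpha>)"
  proof (rule homI)
    fix x assume "x \<in> carrier unit_group"
    then show "unit_aut x \<in> carrier (Aut_holonomy \<alpha>)"
      by (simp add: unit_group_def Aut_holonomy_def unit_aut_linear unit_aut_bij unit_aut_preserves)
  next
    fix x y assume "x \<in> carrier unit_group" "y \<in> carrier unit_group"
    then show "unit_aut (x \<otimes>\<^bsub>unit_group\<^esub> y) = unit_aut x \<otimes>\<^bsub>Aut_holonomy \<alpha>\<^esub> unit_aut y"
      by (simp add: unit_group_def Aut_holonomy_def BijGroup_def Bij_def unit_aut_bij fun_eq_iff
          compose_def unit_aut_mult)
  qed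
  show "bij_betw unit_aut (carrier unit_group) (carrier (Aut_holonomy \<alpha>))"
    unfolding bij_betw_def
  proof
    show "inj_on unit_aut (carrier unit_group)"
      by (rule inj_onI) (simp add: unit_group_def unit_aut_inj)
    show "unit_aut ` carrier unit_group = carrier (Aut_holonomy \<alpha>)"
    proof (intro equalityI subsetI)
      fix \<phi> assume "\<phi> \<in> unit_aut ` carrier unit_group"
      then obtain x where "x \<in> multiplier_units" "\<phi> = unit_aut x" by (auto simp: unit_group_def)
      then show "\<phi> \<in> carrier (Aut_holonomy \<alpha>)"
        by (simp add: Aut_holonomy_def unit_aut_linear unit_aut_bij unit_aut_preserves)
    next
      fix \<phi> assume "\<phi> \<in> carrier (Aut_holonomy \<alpha>)"
      then have "linear \<phi>" "bij \<phi>" "\<phi> ` \<Gamma> = \<Gamma>" by (simp_all add: Aut_holonomy_def)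
      then obtain x where "x \<in> multiplier_units" "\<phi> = unit_aut x" by (rule unit_aut_surj)
      then show "\<phi> \<in> unit_aut ` carrier unit_group" by (simp add: unit_group_def)
    qed
  qed
qed

end


section \<open>The group of diffeomorphisms\<close>

text \<open>The isomorphism is constructed out of the semidirect product, while the theorem states
  it in the other direction. Closure under multiplication is what inverting it takes.\<close>

lemma is_iso_of_inverse:
  assumes f: "f \<in> hom G H" "bij_betw f (carrier G) (carrier H)"
    and closed: "\<And>x y. x \<in> carrier G \<Longrightarrow> y \<in> carrier G \<Longrightarrow> x \<otimes>\<^bsub>G\<^esub> y \<in> carrier G"
  shows "H \<cong> G"
proof -
  let ?g = "inv_into (carrier G) f"
  have g: "?g y \<in> carrier G" "f (?g y) = y" if "y \<in> carrier H" for y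
    using that f(2) by (auto simp: bij_betw_def inv_into_into f_inv_into_f)
  have "?g \<in> iso H G"
  proof (rule isoI[OF homI])
    show "bij_betw ?g (carrier H) (carrier G)" using f(2) by (rule bij_betw_inv_into)
    show "?g x \<in> carrier G" if "x \<in> carrier H" for x using g that by blast
    show "?g (x \<otimes>\<^bsub>H\<^esub> y) = ?g x \<otimes>\<^bsub>G\<^esub> ?g y" if "x \<in> carrier H" "y \<in> carrier H" for x y
    proof -
      have "f (?g x \<otimes>\<^bsub>G\<^esub> ?g y) = x \<otimes>\<^bsub>H\<^esub> y" using hom_mult[OF f(1)] g that by simp
      then show ?thesis using bij_betw_inv_into_left[OF f(2) closed] g that by metis
    qed
  qed
  then show ?thesis by (auto simp: is_iso_def)
qed

context dense_flow
begin

section \<open>The quotient group and its affine transformations\<close>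

abbreviation coset where "coset v \<equiv> \<Gamma> #>\<^bsub>additive_group\<^esub> v"

lemma carrier_holonomy_quotient: "carrier (holonomy_quotient \<alpha>) = range coset"
  by (auto simp: holonomy_quotient_def FactGroup_def RCOSETS_def additive_group_def)

lemma mult_holonomy_quotient: "coset v \<otimes>\<^bsub>holonomy_quotient \<alpha>\<^esub> coset w = coset (v + w)"
proof -
  have "coset v \<otimes>\<^bsub>holonomy_quotient \<alpha>\<^esub> coset w = {x + y |x y. x \<in> coset v \<and> y \<in> coset w}"
    by (auto simp: holonomy_quotient_def FactGroup_def set_mult_def additive_group_def)
  also have "\<dots> = coset (v + w)"
  proof (intro equalityI subsetI)
    fix z assume "z \<in> {x + y |x y. x \<in> coset v \<and> y \<in> coset w}"
    then obtain x y where "z = x + y" "x - v \<in> \<Gamma>" "y - w \<in> \<Gamma>" by (auto simp: mem_coset)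
    then show "z \<in> coset (v + w)" using add[of "x - v" "y - w"] by (simp add: mem_coset algebra_simps)
  next
    fix z assume z: "z \<in> coset (v + w)"
    then have "z - w \<in> coset v" "w \<in> coset w" by (simp_all add: mem_coset algebra_simps holonomy_group_zero)
    then show "z \<in> {x + y |x y. x \<in> coset v \<and> y \<in> coset w}" by force
  qed
  finally show ?thesis .
qed

lemma image_coset:
  assumes "linear \<phi>" "\<phi> ` \<Gamma> = \<Gamma>"
  shows "\<phi> ` coset v = coset (\<phi> v)"
proof -
  have coset: "coset u = (\<lambda>h. h + u) ` \<Gamma>" for u by (auto simp: r_coset_def additive_group_def)
  have "\<phi> ` coset v = (\<lambda>h. h + \<phi> v) ` (\<phi> ` \<Gamma>)"
    by (simp only: coset image_image linear_add[OF assms(1)])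
  then show ?thesis by (simp only: assms(2) coset)
qed

definition leaf_rep where "leaf_rep l = (SOME v. leaf_of \<alpha> v = l)"

definition coset_rep where "coset_rep C = (SOME v. coset v = C)"

text \<open>The map of leaves induced by \<open>v \<mapsto> \<phi> v + c\<close>, for
  \<open>c\<close> in the coset \<open>C\<close>. It is restricted because members of
  \<open>Bij\<close> are extensional.\<close>

definition affine_leaf_map where
  "affine_leaf_map \<phi> C = (\<lambda>l\<in>range (leaf_of \<alpha>). leaf_of \<alpha> (\<phi> (leaf_rep l) + coset_rep C))"

text \<open>The chosen representatives differ from \<open>v\<close> and \<open>b\<close> by elements
  of \<open>\<Gamma>\<close>, which \<open>\<phi>\<close> keeps in \<open>\<Gamma>\<close>.\<close>

lemma affine_leaf_map_leaf_of:
  assumes "linear \<phi>" "\<phi> ` \<Gamma> = \<Gamma>"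
  shows "affine_leaf_map \<phi> (coset b) (leaf_of \<alpha> v) = leaf_of \<alpha> (\<phi> v + b)"
proof -
  have "leaf_of \<alpha> (leaf_rep (leaf_of \<alpha> v)) = leaf_of \<alpha> v" unfolding leaf_rep_def by (rule someI) simp
  then have 1: "leaf_rep (leaf_of \<alpha> v) - v \<in> \<Gamma>" by (simp add: leaf_of_eq_iff)
  have "coset (coset_rep (coset b)) = coset b" unfolding coset_rep_def by (rule someI) simp
  then have 2: "coset_rep (coset b) - b \<in> \<Gamma>" by (simp add: coset_eq_iff)
  have "\<phi> (leaf_rep (leaf_of \<alpha> v) - v) \<in> \<Gamma>" using 1 assms(2) by blast
  from add[OF this 2] have "leaf_of \<alpha> (\<phi> (leaf_rep (leaf_of \<alpha> v)) + coset_rep (coset b)) = leaf_of \<alpha> (\<phi> v + b)"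
    by (simp add: leaf_of_eq_iff linear_diff[OF assms(1)] algebra_simps)
  then show ?thesis unfolding affine_leaf_map_def restrict_apply'[OF rangeI] .
qed

lemma points_leaf_space: "points (leaf_space \<alpha>) = range (leaf_of \<alpha>)"
  by (simp add: leaf_space_eq points_quotient_standard)

lemma carrier_Diff: "h \<in> carrier (Diff (leaf_space \<alpha>)) \<longleftrightarrow>
    h \<in> extensional (range (leaf_of \<alpha>)) \<and> diffeomorphism (leaf_space \<alpha>) (leaf_space \<alpha>) h"
  by (auto simp: Diff_def Bij_def diffeomorphism_def points_leaf_space)

lemma affine_leaf_map_Diff:
  assumes "linear \<phi>" "bij \<phi>" "\<phi> ` \<Gamma> = \<Gamma>"
  shows "affine_leaf_map \<phi> (coset b) \<in> carrier (Diff (leaf_space \<alpha>))"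
  unfolding carrier_Diff unfolding leaf_space_eq
proof
  show "affine_leaf_map \<phi> (coset b) \<in> extensional (range (leaf_of \<alpha>))"
    by (simp add: affine_leaf_map_def)
  show "diffeomorphism Q Q (affine_leaf_map \<phi> (coset b))"
    using assms affine_leaf_map_leaf_of by (intro affine_diffeomorphism[of \<phi>]) auto
qed

lemma Diff_imp_affine_leaf_map:
  assumes "h \<in> carrier (Diff (leaf_space \<alpha>))"
  obtains \<phi> b where "linear \<phi>" "bij \<phi>" "\<phi> ` \<Gamma> = \<Gamma>" "h = affine_leaf_map \<phi> (coset b)"
proof -
  have h: "h \<in> extensional (range (leaf_of \<alpha>))" "diffeomorphism Q Q h"
    using assms unfolding carrier_Diff unfolding leaf_space_eq by auto
  obtain \<phi> b where \<phi>: "linear \<phi>" "bij \<phi>" "\<phi> ` \<Gamma> = \<Gamma>" "\<And>x. h (leaf_of \<alpha> x) = leaf_of \<alpha> (\<phi> x + b)"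
    using diffeomorphism_imp_affine[OF h(2)] by blast
  have "h = affine_leaf_map \<phi> (coset b)"
  proof (rule extensionalityI[OF h(1)])
    show "affine_leaf_map \<phi> (coset b) \<in> extensional (range (leaf_of \<alpha>))"
      by (simp add: affine_leaf_map_def)
    show "h l = affine_leaf_map \<phi> (coset b) l" if "l \<in> range (leaf_of \<alpha>)" for l
      using that \<phi> by (auto simp: affine_leaf_map_leaf_of)
  qed
  then show ?thesis using that \<phi>(1-3) by blast
qed

lemma affine_leaf_map_inj:
  assumes \<phi>: "linear \<phi>" "\<phi> ` \<Gamma> = \<Gamma>" and \<psi>: "linear \<psi>" "\<psi> ` \<Gamma> = \<Gamma>"
    and eq: "affine_leaf_map \<phi> (coset b) = affine_leaf_map \<psi> (coset c)"
  shows "\<phi> = \<psi>" "coset b = coset c"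
proof -
  have "\<phi> x + b - (\<psi> x + c) \<in> \<Gamma>" for x
    using fun_cong[OF eq, of "leaf_of \<alpha> x"]
    by (simp only: affine_leaf_map_leaf_of[OF \<phi>] affine_leaf_map_leaf_of[OF \<psi>] leaf_of_eq_iff)
  note u = affine_cong_unique[OF \<phi>(1) \<psi>(1) this]
  show "\<phi> = \<psi>" by (rule u(1))
  show "coset b = coset c" unfolding coset_eq_iff by (rule u(2))
qed

lemma mult_Diff:
  assumes g: "g \<in> carrier (Diff (leaf_space \<alpha>))" and h: "h \<in> carrier (Diff (leaf_space \<alpha>))"
  shows "g \<otimes>\<^bsub>Diff (leaf_space \<alpha>)\<^esub> h = compose (range (leaf_of \<alpha>)) g h"
  using assms by (simp add: Diff_def BijGroup_def points_leaf_space)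

text \<open>The pair \<open>(a, coset v)\<close> acts on leaves by
  \<open>x \<mapsto> \<theta> a x + v\<close>, and composing two such maps gives the semidirect
  multiplication. Surjectivity holds as all diffeomorphisms are affine, injectivity by uniqueness of
  affine lifts.\<close>

lemma Diff_iso_semidirect_product:
  assumes H: "group H" and \<theta>: "\<theta> \<in> iso H (Aut_holonomy \<alpha>)"
  shows "Diff (leaf_space \<alpha>) \<cong> semidirect_product H (holonomy_quotient \<alpha>) (\<lambda>a C. \<theta> a ` C)"
proof -
  let ?S = "semidirect_product H (holonomy_quotient \<alpha>) (\<lambda>a C. \<theta> a ` C)"
  let ?D = "Diff (leaf_space \<alpha>)"
  interpret H: group H by (fact H)
  have aut: "linear (\<theta> a)" "bij (\<theta> a)" "\<theta> a ` \<Gamma> = \<Gamma>" if "a \<in> carrier H" for a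
    using hom_in_carrier[of \<theta> H "Aut_holonomy \<alpha>" a] \<theta> that by (simp_all add: iso_def Aut_holonomy_def)
  have \<theta>_mult: "\<theta> (a \<otimes>\<^bsub>H\<^esub> b) = \<theta> a \<circ> \<theta> b" if "a \<in> carrier H" "b \<in> carrier H" for a b
    using hom_mult[of \<theta> H "Aut_holonomy \<alpha>" a b] \<theta> that aut(2)
    by (simp add: iso_def Aut_holonomy_def BijGroup_def Bij_def compose_def fun_eq_iff)
  have \<theta>_bij: "bij_betw \<theta> (carrier H) (carrier (Aut_holonomy \<alpha>))" using \<theta> by (simp add: iso_def)
  have S: "carrier ?S = carrier H \<times> range coset"
    by (simp add: semidirect_product_def carrier_holonomy_quotient)
  have S_mult: "(a, coset v) \<otimes>\<^bsub>?S\<^esub> (b, coset w) = (a \<otimes>\<^bsub>H\<^esub> b, coset (v + \<theta> a w))" if "a \<in> carrier H" for a b v w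
    by (simp add: semidirect_product_def image_coset[OF aut(1,3)[OF that]] mult_holonomy_quotient)
  define \<Psi> where "\<Psi> = (\<lambda>(a, C). affine_leaf_map (\<theta> a) C)"
  have \<Psi>D: "\<Psi> (a, coset v) \<in> carrier ?D" if "a \<in> carrier H" for a v
    using affine_leaf_map_Diff[OF aut[OF that]] by (simp add: \<Psi>_def)
  have \<Psi>: "\<Psi> (a, coset v) (leaf_of \<alpha> x) = leaf_of \<alpha> (\<theta> a x + v)" if "a \<in> carrier H" for a v x
    using affine_leaf_map_leaf_of[OF aut(1,3)[OF that]] by (simp add: \<Psi>_def)
  show ?thesis
  proof (rule is_iso_of_inverse[of \<Psi>])
    show "\<Psi> \<in> hom ?S ?D"
    proof (rule homI)
      fix x assume "x \<in> carrier ?S"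
      then show "\<Psi> x \<in> carrier ?D" unfolding S using \<Psi>D by auto
    next
      fix x y assume "x \<in> carrier ?S" "y \<in> carrier ?S"
      then obtain a v b w where x: "x = (a, coset v)" "a \<in> carrier H" and y: "y = (b, coset w)" "b \<in> carrier H"
        unfolding S by blast
      have ab: "a \<otimes>\<^bsub>H\<^esub> b \<in> carrier H" using x y by simp
      have "\<Psi> (a \<otimes>\<^bsub>H\<^esub> b, coset (v + \<theta> a w)) = compose (range (leaf_of \<alpha>)) (\<Psi> (a, coset v)) (\<Psi> (b, coset w))"
      proof (rule extensionalityI)
        show "\<Psi> (a \<otimes>\<^bsub>H\<^esub> b, coset (v + \<theta> a w)) \<in> extensional (range (leaf_of \<alpha>))"
          using \<Psi>D[OF ab] by (simp add: carrier_Diff)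
        fix l assume "l \<in> range (leaf_of \<alpha>)"
        then obtain z where "l = leaf_of \<alpha> z" by blast
        then show "\<Psi> (a \<otimes>\<^bsub>H\<^esub> b, coset (v + \<theta> a w)) l = compose (range (leaf_of \<alpha>)) (\<Psi> (a, coset v)) (\<Psi> (b, coset w)) l"
          by (simp add: compose_def \<Psi>[OF ab] \<Psi>[OF x(2)] \<Psi>[OF y(2)] \<theta>_mult[OF x(2) y(2)]
              linear_add[OF aut(1)[OF x(2)]] add_ac)
      qed (rule compose_extensional)
      then show "\<Psi> (x \<otimes>\<^bsub>?S\<^esub> y) = \<Psi> x \<otimes>\<^bsub>?D\<^esub> \<Psi> y"
        unfolding x(1) y(1) S_mult[OF x(2)] mult_Diff[OF \<Psi>D[OF x(2)] \<Psi>D[OF y(2)]] .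
    qed
    show "bij_betw \<Psi> (carrier ?S) (carrier ?D)"
      unfolding bij_betw_def
    proof
      show "inj_on \<Psi> (carrier ?S)"
      proof (rule inj_onI)
        fix x y assume "x \<in> carrier ?S" "y \<in> carrier ?S" and eq: "\<Psi> x = \<Psi> y"
        then obtain a v b w where x: "x = (a, coset v)" "a \<in> carrier H" and y: "y = (b, coset w)" "b \<in> carrier H"
          unfolding S by blast
        have "affine_leaf_map (\<theta> a) (coset v) = affine_leaf_map (\<theta> b) (coset w)"
          using eq by (simp add: x y \<Psi>_def)
        note u = affine_leaf_map_inj[OF aut(1,3)[OF x(2)] aut(1,3)[OF y(2)] this]
        have "a = b" using inj_onD[OF bij_betw_imp_inj_on[OF \<theta>_bij] u(1) x(2) y(2)] .
        then show "x = y" using u(2) by (simp add: x y)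
      qed
      show "\<Psi> ` carrier ?S = carrier ?D"
      proof (intro equalityI subsetI)
        show "h \<in> carrier ?D" if "h \<in> \<Psi> ` carrier ?S" for h using that \<Psi>D unfolding S by auto
        fix h assume "h \<in> carrier ?D"
        then obtain \<phi> b where \<phi>: "linear \<phi>" "bij \<phi>" "\<phi> ` \<Gamma> = \<Gamma>" "h = affine_leaf_map \<phi> (coset b)"
          by (rule Diff_imp_affine_leaf_map)
        then have "\<phi> \<in> carrier (Aut_holonomy \<alpha>)" by (simp add: Aut_holonomy_def)
        then obtain a where "a \<in> carrier H" "\<phi> = \<theta> a"
          using bij_betw_imp_surj_on[OF \<theta>_bij] by blast
        then show "h \<in> \<Psi> ` carrier ?S"
          unfolding S by (intro image_eqI[of _ _ "(a, coset b)"]) (simp_all add: \<phi>(4) \<Psi>_def)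
      qed
    qed
    fix x y assume "x \<in> carrier ?S" "y \<in> carrier ?S"
    then obtain a v b w where "x = (a, coset v)" "a \<in> carrier H" "y = (b, coset w)" "b \<in> carrier H"
      unfolding S by blast
    then show "x \<otimes>\<^bsub>?S\<^esub> y \<in> carrier ?S" by (simp add: S_mult) (simp add: S)
  qed
qed

end

theorem corollary7p2:
  fixes \<alpha> :: "real ^ 'n"
  assumes "dense_leaves \<alpha>"
  shows "diffeomorphism (leaf_space \<alpha>) (holonomy_quotient_space \<alpha>) (leaf_to_coset \<alpha>) \<and>
    (\<exists>r::nat. r \<le> CARD('n) \<and>
      (let Z2_Zr = integer_mod_group 2 \<times>\<times> product_group {..<r} (\<lambda>_. integer_group)
       in \<exists>\<theta> \<in> iso Z2_Zr (Aut_holonomy \<alpha>).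
            Diff (leaf_space \<alpha>) \<cong>
              semidirect_product Z2_Zr (holonomy_quotient \<alpha>) (\<lambda>a C. \<theta> a ` C)))"
proof
  show "diffeomorphism (leaf_space \<alpha>) (holonomy_quotient_space \<alpha>) (leaf_to_coset \<alpha>)"
    by (rule diffeomorphism_leaf_to_coset)
next
  interpret dense_flow \<alpha> by unfold_locales (fact assms)
  let ?H = "\<lambda>r. integer_mod_group 2 \<times>\<times> product_group {..<r} (\<lambda>_. integer_group)"
  \<comment> \<open>The type \<open>'n option\<close> has one element more than \<open>'n\<close>,
    so the strict bound gives \<open>r \<le> CARD('n)\<close>.\<close>
  obtain r f where r: "r < CARD('n option)" and f: "f \<in> iso (?H r) unit_group"
    by (rule unit_group_iso)
  have \<theta>: "unit_aut \<circ> f \<in> iso (?H r) (Aut_holonomy \<alpha>)"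
    using f unit_aut_iso by (rule iso_set_trans)
  have "group (?H r)"
    by (intro DirProd_group product_group) (simp_all add: group_integer_mod_group)
  from Diff_iso_semidirect_product[OF this \<theta>] \<theta> r
  show "\<exists>r::nat. r \<le> CARD('n) \<and>
      (let Z2_Zr = integer_mod_group 2 \<times>\<times> product_group {..<r} (\<lambda>_. integer_group)
       in \<exists>\<theta> \<in> iso Z2_Zr (Aut_holonomy \<alpha>).
            Diff (leaf_space \<alpha>) \<cong>
              semidirect_product Z2_Zr (holonomy_quotient \<alpha>) (\<lambda>a C. \<theta> a ` C))"
    unfolding Let_def by (intro exI[of _ r] conjI bexI[of _ "unit_aut \<circ> f"]) simp_all
qed

end
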